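(* Assume that $E\subset\mathbb{R}$ is a (compact) semi-regular set, $x_*\in\overline{\mathbb{R}}\setminus E$, and that $E^{\mathrm{reg}}$ is a finite union of closed intervals. Then \[ \mathcal{IR}(E,x_* )<\infty\quad\Longleftrightarrow\quad \sum_{x\in E^{\mathrm{ir}}}\mathrm{dist}(x,E^{\mathrm{reg}})^{1/2}<\infty, \] where the sum on the right is understood to be infinite if $E^{\mathrm{ir}}$ is uncountable.
   Context: $\overline{\mathbb{R}}=\mathbb{R}\cup\{\infty\}$. For a compact non-polar set $E\subset\mathbb{R}$ (i.e. of positive logarithmic capacity), $G_E(z,x_* )$ is the Green function of $\Omega_E=\overline{\mathbb{C}}\setminus E$ with pole at $x_*$. It is extended to $x\in E$ by the upper boundary value $G_E(x,x_* )=\limsup_{\Omega_E\ni z\to x}G_E(z,x_* )$. A point $x\in E$ is regular if $G_E(x,x_* )=0$ and irregular if $G_E(x,x_* )>0$ (independent of $x_*$); $E^{\mathrm{reg}}$, $E^{\mathrm{ir}}$ denote the sets of regular and irregular points. A compact non-polar set $E$ is semi-regular if $E^{\mathrm{reg}}$ is closed. Irregularity coefficient: $\mathcal{IR}(E,x_* )=\sum_{x\in E^{\mathrm{ir}}}G_E(x,x_* )\in[0,\infty]$, equal to $0$ if $E^{\mathrm{ir}}=\emptyset$ and to $\infty$ if $E^{\mathrm{ir}}$ is uncountable. *)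

theory Defs
  imports "HOL-Analysis.Analysis"
begin

section \<open>The Riemann sphere and the extended real line\<close>

text \<open>The Riemann sphere is modelled by \<^typ>\<open>complex option\<close>, with \<^term>\<open>None\<close> as the point at
  infinity.\<close>

type_synonym sphere = "complex option"

definition real_pts :: "real set \<Rightarrow> sphere set" where
  "real_pts E = (\<lambda>x. Some (complex_of_real x)) ` E"

definition extended_reals :: "sphere set" where
  "extended_reals = insert None (real_pts UNIV)"

definition Omega :: "real set \<Rightarrow> sphere set" where
  "Omega E = - real_pts E"

text \<open>A holomorphic chart centred at each point of the sphere: translation at a finite point,
  inversion at infinity.\<close>

fun chart :: "sphere \<Rightarrow> complex \<Rightarrow> sphere" where
  "chart (Some a) \<zeta> = Some (a + \<zeta>)"
| "chart None \<zeta> = (if \<zeta> = 0 then None else Some (inverse \<zeta>))"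


section \<open>Harmonic functions\<close>

text \<open>Twice continuously differentiable with vanishing Laplacian; the witnesses are the first and
  second partial derivatives.\<close>

definition harmonic_on :: "complex set \<Rightarrow> (complex \<Rightarrow> real) \<Rightarrow> bool" where
  "harmonic_on S u \<longleftrightarrow> open S \<and>
     (\<exists>ux uy uxx uxy uyx uyy.
        (\<forall>z\<in>S. (u has_derivative (\<lambda>h. ux z * Re h + uy z * Im h)) (at z) \<and>
               (ux has_derivative (\<lambda>h. uxx z * Re h + uxy z * Im h)) (at z) \<and>
               (uy has_derivative (\<lambda>h. uyx z * Re h + uyy z * Im h)) (at z) \<and>
               uxx z + uyy z = 0) \<and>
        continuous_on S uxx \<and> continuous_on S uxy \<and> continuous_on S uyx \<and> continuous_on S uyy)"

definition sphere_harmonic_on :: "sphere set \<Rightarrow> (sphere \<Rightarrow> real) \<Rightarrow> bool" where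
  "sphere_harmonic_on S u \<longleftrightarrow>
     (\<forall>p\<in>S. \<exists>r>0. chart p ` ball 0 r \<subseteq> S \<and> harmonic_on (ball 0 r) (u \<circ> chart p))"

text \<open>\<open>u(z) + log |z - w|\<close> (for infinite \<open>w\<close>: \<open>u(z) - log |z|\<close>) extends harmonically across \<open>w\<close>.\<close>

definition log_pole :: "sphere \<Rightarrow> (sphere \<Rightarrow> real) \<Rightarrow> bool" where
  "log_pole w u \<longleftrightarrow>
     (\<exists>r>0. \<exists>h. harmonic_on (ball 0 r) h \<and>
        (\<forall>\<zeta>\<in>ball 0 r - {0}. u (chart w \<zeta>) = h \<zeta> - ln (cmod \<zeta>)))"


section \<open>Logarithmic capacity\<close>

definition log_kernel :: "complex \<Rightarrow> complex \<Rightarrow> ereal" where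
  "log_kernel z w = (if z = w then \<infinity> else ereal (- ln (cmod (z - w))))"

text \<open>Positive minus negative part of the double integral of the kernel; the negative part is finite
  for probability measures carried by a bounded set.\<close>

definition log_energy :: "complex measure \<Rightarrow> ereal" where
  "log_energy \<mu> =
     enn2ereal (\<integral>\<^sup>+ z. \<integral>\<^sup>+ w. e2ennreal (log_kernel z w) \<partial>\<mu> \<partial>\<mu>)
   - enn2ereal (\<integral>\<^sup>+ z. \<integral>\<^sup>+ w. e2ennreal (- log_kernel z w) \<partial>\<mu> \<partial>\<mu>)"

definition prob_measures_on :: "complex set \<Rightarrow> complex measure set" where
  "prob_measures_on K = {\<mu>. sets \<mu> = sets borel \<and> emeasure \<mu> UNIV = 1 \<and> emeasure \<mu> K = 1}"

definition robin_constant :: "complex set \<Rightarrow> ereal" where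
  "robin_constant K = (INF \<mu>\<in>prob_measures_on K. log_energy \<mu>)"

text \<open>For compact sets only, where the Robin constant is never \<open>- \<infinity>\<close>.\<close>

definition log_capacity :: "complex set \<Rightarrow> real" where
  "log_capacity K =
     (if robin_constant K = \<infinity> then 0 else exp (- real_of_ereal (robin_constant K)))"

definition non_polar :: "real set \<Rightarrow> bool" where
  "non_polar E \<longleftrightarrow> log_capacity (complex_of_real ` E) > 0"


section \<open>The Green function\<close>

text \<open>The Green function of \<^term>\<open>Omega E\<close> with pole \<open>w\<close> is the least positive harmonic function
  on \<^term>\<open>Omega E - {w}\<close> with a logarithmic pole at \<open>w\<close>. For non-polar \<open>E\<close> the family below has a
  least element, namely its pointwise infimum.\<close>

definition green_candidates :: "real set \<Rightarrow> sphere \<Rightarrow> (sphere \<Rightarrow> real) set" where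
  "green_candidates E w =
     {u. sphere_harmonic_on (Omega E - {w}) u \<and> (\<forall>z\<in>Omega E - {w}. u z > 0) \<and> log_pole w u}"

definition green :: "real set \<Rightarrow> sphere \<Rightarrow> sphere \<Rightarrow> ennreal" where
  "green E w z = (if z = w then \<infinity> else (INF u\<in>green_candidates E w. ennreal (u z)))"

text \<open>The extension to \<open>x \<in> E\<close> by the upper boundary value.\<close>

definition green_bdry :: "real set \<Rightarrow> sphere \<Rightarrow> real \<Rightarrow> ennreal" where
  "green_bdry E w x =
     Limsup (at (complex_of_real x) within {z. Some z \<in> Omega E}) (\<lambda>z. green E w (Some z))"


section \<open>Regular and irregular points\<close>

text \<open>Regularity does not depend on the pole; we take the pole at infinity, which is available for
  every compact \<open>E\<close>.\<close>

definition regular_points :: "real set \<Rightarrow> real set" where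
  "regular_points E = {x\<in>E. green_bdry E None x = 0}"

definition irregular_points :: "real set \<Rightarrow> real set" where
  "irregular_points E = {x\<in>E. green_bdry E None x > 0}"

definition semi_regular :: "real set \<Rightarrow> bool" where
  "semi_regular E \<longleftrightarrow> compact E \<and> non_polar E \<and> closed (regular_points E)"

text \<open>Sums of nonnegative terms, by convention infinite over an uncountable index set.\<close>

definition conv_sum :: "(real \<Rightarrow> ennreal) \<Rightarrow> real set \<Rightarrow> ennreal" where
  "conv_sum f A = (if countable A then infsum f A else \<infinity>)"

definition irregularity_coeff :: "real set \<Rightarrow> sphere \<Rightarrow> ennreal" where
  "irregularity_coeff E w = conv_sum (green_bdry E w) (irregular_points E)"

end

theory Submission
  imports Defs "HOL-Complex_Analysis.Cauchy_Integral_Formula"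
begin

text \<open>If \<open>E\<^sup>i\<^sup>r\<close> is uncountable, both sides are infinite. Otherwise \<open>E\<close> is a finite union \<open>K\<close> of
  nondegenerate intervals together with a countable set, so Kellogg's theorem can be avoided: non-polarity
  makes \<open>E\<close> uncountable, hence \<open>K\<close> nonempty, and countable sets are invisible to the minimum
  principle. It then suffices to show that \<open>G\<^sub>E(x, \<infinity>)\<close> is comparable to \<open>dist(x, K)\<^sup>1\<^sup>/\<^sup>2\<close> on
  \<open>E - K\<close>; a finite pole is moved to infinity by an inversion, which is bi-Lipschitz on \<open>E\<close>.
  The upper bound is the explicit Green function of the single interval of \<open>K\<close> nearest to \<open>x\<close>.
  For the lower bound, \<open>x\<close> lies in a gap \<open>(p, q)\<close> of \<open>K\<close>, and \<open>G\<^sub>E\<close> dominates the Green function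
  of two intervals that are symmetric about the midpoint of the gap, which a quadratic polynomial reduces to that
  of one interval. Degenerate intervals among the regular points are excluded by the same lower bound.\<close>

section \<open>Harmonic functions\<close>

text \<open>\<open>green\<close> is an infimum over positive functions on which no boundary
  condition on \<open>E\<close> is imposed. An upper bound therefore needs a single candidate,
  whereas a lower bound has to hold for every candidate. The obstacle is the countable set
  \<open>C\<close>: it may accumulate at \<open>K\<close>, the comparison function can be positive
  on it, and near it a candidate is known only to be positive. A logarithmic potential with finitely
  many poles in \<open>C\<close>, taken with an arbitrarily small factor, pays for this. The
  exponent 1/2 is that of arcosh at 1, since arcosh (1 + t) is comparable to sqrt t for small t. The
  sums may have infinitely many terms, so the constants must not depend on the point; they are built
  from the shortest interval, the shortest gap, the size of \<open>E\<close> and, for a finite pole,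
  its distances to \<open>E\<close>.\<close>

lemma harmonic_onI:
  assumes "open S"
    and "\<And>z. z \<in> S \<Longrightarrow> (u has_derivative (\<lambda>h. ux z * Re h + uy z * Im h)) (at z)"
    and "\<And>z. z \<in> S \<Longrightarrow> (ux has_derivative (\<lambda>h. uxx z * Re h + uxy z * Im h)) (at z)"
    and "\<And>z. z \<in> S \<Longrightarrow> (uy has_derivative (\<lambda>h. uyx z * Re h + uyy z * Im h)) (at z)"
    and "\<And>z. z \<in> S \<Longrightarrow> uxx z + uyy z = 0"
    and "continuous_on S uxx" "continuous_on S uxy" "continuous_on S uyx" "continuous_on S uyy"
  shows "harmonic_on S u"
  unfolding harmonic_on_def
  by (rule conjI[OF assms(1)], rule exI[of _ ux], rule exI[of _ uy], rule exI[of _ uxx],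
      rule exI[of _ uxy], rule exI[of _ uyx], rule exI[of _ uyy]) (simp add: assms)

lemma harmonic_onE:
  assumes "harmonic_on S u"
  obtains ux uy uxx uxy uyx uyy where "open S"
    and "\<And>z. z \<in> S \<Longrightarrow> (u has_derivative (\<lambda>h. ux z * Re h + uy z * Im h)) (at z)"
    and "\<And>z. z \<in> S \<Longrightarrow> (ux has_derivative (\<lambda>h. uxx z * Re h + uxy z * Im h)) (at z)"
    and "\<And>z. z \<in> S \<Longrightarrow> (uy has_derivative (\<lambda>h. uyx z * Re h + uyy z * Im h)) (at z)"
    and "\<And>z. z \<in> S \<Longrightarrow> uxx z + uyy z = 0"
    and "continuous_on S uxx" "continuous_on S uxy" "continuous_on S uyx" "continuous_on S uyy"
  using assms unfolding harmonic_on_def by blast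

lemma harmonic_on_subset:
  assumes "harmonic_on S u" "open T" "T \<subseteq> S"
  shows "harmonic_on T u"
  using assms(1)
proof (rule harmonic_onE)
  fix ux uy uxx uxy uyx uyy
  assume d: "\<And>z. z \<in> S \<Longrightarrow> (u has_derivative (\<lambda>h. ux z * Re h + uy z * Im h)) (at z)"
      "\<And>z. z \<in> S \<Longrightarrow> (ux has_derivative (\<lambda>h. uxx z * Re h + uxy z * Im h)) (at z)"
      "\<And>z. z \<in> S \<Longrightarrow> (uy has_derivative (\<lambda>h. uyx z * Re h + uyy z * Im h)) (at z)"
      "\<And>z. z \<in> S \<Longrightarrow> uxx z + uyy z = 0"
    and c: "continuous_on S uxx" "continuous_on S uxy" "continuous_on S uyx" "continuous_on S uyy"
  show ?thesis
    using assms(2,3) d c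
    by (intro harmonic_onI[where ux = ux and uy = uy and uxx = uxx and uxy = uxy and uyx = uyx and uyy = uyy])
      (auto intro: continuous_on_subset)
qed

lemma harmonic_on_imp_continuous_on:
  assumes "harmonic_on S u"
  shows "continuous_on S u"
  using assms by (rule harmonic_onE)
    (blast intro: continuous_at_imp_continuous_on has_derivative_continuous)

lemma harmonic_on_cong:
  assumes "harmonic_on S u" "\<And>z. z \<in> S \<Longrightarrow> u z = v z"
  shows "harmonic_on S v"
  using assms(1)
proof (rule harmonic_onE)
  fix ux uy uxx uxy uyx uyy
  assume d: "\<And>z. z \<in> S \<Longrightarrow> (u has_derivative (\<lambda>h. ux z * Re h + uy z * Im h)) (at z)"
      "\<And>z. z \<in> S \<Longrightarrow> (ux has_derivative (\<lambda>h. uxx z * Re h + uxy z * Im h)) (at z)"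
      "\<And>z. z \<in> S \<Longrightarrow> (uy has_derivative (\<lambda>h. uyx z * Re h + uyy z * Im h)) (at z)"
      "\<And>z. z \<in> S \<Longrightarrow> uxx z + uyy z = 0"
    and c: "continuous_on S uxx" "continuous_on S uxy" "continuous_on S uyx" "continuous_on S uyy"
    and "open S"
  have "(v has_derivative (\<lambda>h. ux z * Re h + uy z * Im h)) (at z)" if "z \<in> S" for z
    using has_derivative_transform_within_open[OF d(1)[OF that] \<open>open S\<close> that] assms(2) by blast
  then show ?thesis
    using d(2-4) c \<open>open S\<close>
    by (intro harmonic_onI[where ux = ux and uy = uy and uxx = uxx and uxy = uxy and uyx = uyx and uyy = uyy]) auto
qed

lemma harmonic_on_cmult:
  assumes "harmonic_on S u"
  shows "harmonic_on S (\<lambda>z. c * u z)"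
  using assms
proof (rule harmonic_onE)
  fix ux uy uxx uxy uyx uyy
  assume d: "\<And>z. z \<in> S \<Longrightarrow> (u has_derivative (\<lambda>h. ux z * Re h + uy z * Im h)) (at z)"
      "\<And>z. z \<in> S \<Longrightarrow> (ux has_derivative (\<lambda>h. uxx z * Re h + uxy z * Im h)) (at z)"
      "\<And>z. z \<in> S \<Longrightarrow> (uy has_derivative (\<lambda>h. uyx z * Re h + uyy z * Im h)) (at z)"
      "\<And>z. z \<in> S \<Longrightarrow> uxx z + uyy z = 0"
    and c: "continuous_on S uxx" "continuous_on S uxy" "continuous_on S uyx" "continuous_on S uyy"
    and "open S"
  show ?thesis
  proof (rule harmonic_onI[where ux = "\<lambda>z. c * ux z" and uy = "\<lambda>z. c * uy z"
        and uxx = "\<lambda>z. c * uxx z" and uxy = "\<lambda>z. c * uxy z"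
        and uyx = "\<lambda>z. c * uyx z" and uyy = "\<lambda>z. c * uyy z"])
    fix z assume z: "z \<in> S"
    show "((\<lambda>z. c * u z) has_derivative (\<lambda>h. c * ux z * Re h + c * uy z * Im h)) (at z)"
      by (rule has_derivative_eq_rhs[OF has_derivative_mult_right[OF d(1)[OF z]]])
        (auto simp: algebra_simps)
    show "((\<lambda>z. c * ux z) has_derivative (\<lambda>h. c * uxx z * Re h + c * uxy z * Im h)) (at z)"
      by (rule has_derivative_eq_rhs[OF has_derivative_mult_right[OF d(2)[OF z]]])
        (auto simp: algebra_simps)
    show "((\<lambda>z. c * uy z) has_derivative (\<lambda>h. c * uyx z * Re h + c * uyy z * Im h)) (at z)"
      by (rule has_derivative_eq_rhs[OF has_derivative_mult_right[OF d(3)[OF z]]])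
        (auto simp: algebra_simps)
    show "c * uxx z + c * uyy z = 0"
      using d(4)[OF z] by (metis distrib_left mult_zero_right)
  qed (intro continuous_intros c \<open>open S\<close>)+
qed

lemma harmonic_on_add:
  assumes "harmonic_on S u" "harmonic_on S v"
  shows "harmonic_on S (\<lambda>z. u z + v z)"
  using assms(1)
proof (rule harmonic_onE)
  fix ux uy uxx uxy uyx uyy
  assume d: "\<And>z. z \<in> S \<Longrightarrow> (u has_derivative (\<lambda>h. ux z * Re h + uy z * Im h)) (at z)"
      "\<And>z. z \<in> S \<Longrightarrow> (ux has_derivative (\<lambda>h. uxx z * Re h + uxy z * Im h)) (at z)"
      "\<And>z. z \<in> S \<Longrightarrow> (uy has_derivative (\<lambda>h. uyx z * Re h + uyy z * Im h)) (at z)"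
      "\<And>z. z \<in> S \<Longrightarrow> uxx z + uyy z = 0"
    and c: "continuous_on S uxx" "continuous_on S uxy" "continuous_on S uyx" "continuous_on S uyy"
    and "open S"
  show ?thesis
    using assms(2)
  proof (rule harmonic_onE)
    fix vx vy vxx vxy vyx vyy
    assume e: "\<And>z. z \<in> S \<Longrightarrow> (v has_derivative (\<lambda>h. vx z * Re h + vy z * Im h)) (at z)"
        "\<And>z. z \<in> S \<Longrightarrow> (vx has_derivative (\<lambda>h. vxx z * Re h + vxy z * Im h)) (at z)"
        "\<And>z. z \<in> S \<Longrightarrow> (vy has_derivative (\<lambda>h. vyx z * Re h + vyy z * Im h)) (at z)"
        "\<And>z. z \<in> S \<Longrightarrow> vxx z + vyy z = 0"
      and c': "continuous_on S vxx" "continuous_on S vxy" "continuous_on S vyx" "continuous_on S vyy"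
    show ?thesis
    proof (rule harmonic_onI[where ux = "\<lambda>z. ux z + vx z" and uy = "\<lambda>z. uy z + vy z"
          and uxx = "\<lambda>z. uxx z + vxx z" and uxy = "\<lambda>z. uxy z + vxy z"
          and uyx = "\<lambda>z. uyx z + vyx z" and uyy = "\<lambda>z. uyy z + vyy z"])
      fix z assume z: "z \<in> S"
      show "((\<lambda>z. u z + v z) has_derivative (\<lambda>h. (ux z + vx z) * Re h + (uy z + vy z) * Im h)) (at z)"
        by (rule has_derivative_eq_rhs[OF has_derivative_add[OF d(1)[OF z] e(1)[OF z]]])
          (auto simp: algebra_simps)
      show "((\<lambda>z. ux z + vx z) has_derivative (\<lambda>h. (uxx z + vxx z) * Re h + (uxy z + vxy z) * Im h)) (at z)"
        by (rule has_derivative_eq_rhs[OF has_derivative_add[OF d(2)[OF z] e(2)[OF z]]])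
          (auto simp: algebra_simps)
      show "((\<lambda>z. uy z + vy z) has_derivative (\<lambda>h. (uyx z + vyx z) * Re h + (uyy z + vyy z) * Im h)) (at z)"
        by (rule has_derivative_eq_rhs[OF has_derivative_add[OF d(3)[OF z] e(3)[OF z]]])
          (auto simp: algebra_simps)
      show "uxx z + vxx z + (uyy z + vyy z) = 0"
        using d(4)[OF z] e(4)[OF z] by simp
    qed (intro continuous_intros c c' \<open>open S\<close>)+
  qed
qed

lemma harmonic_on_const:
  "open S \<Longrightarrow> harmonic_on S (\<lambda>z. c)"
  by (rule harmonic_onI[where ux = "\<lambda>z. 0" and uy = "\<lambda>z. 0" and uxx = "\<lambda>z. 0"
        and uxy = "\<lambda>z. 0" and uyx = "\<lambda>z. 0" and uyy = "\<lambda>z. 0"]) auto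

lemma harmonic_on_sum:
  assumes "finite F" "open S" "\<And>i. i \<in> F \<Longrightarrow> harmonic_on S (u i)"
  shows "harmonic_on S (\<lambda>z. \<Sum>i\<in>F. u i z)"
  using assms(1,3)
proof (induction F rule: finite_induct)
  case empty
  then show ?case using harmonic_on_const[OF \<open>open S\<close>, of 0] by simp
next
  case (insert x F)
  then show ?case using harmonic_on_add[of S "u x" "\<lambda>z. \<Sum>i\<in>F. u i z"] by simp
qed

text \<open>The Laplacian of u o f is |f'|^2 times that of \<open>u\<close> at \<open>f\<close>. In
  the sum of the pure second derivatives the terms with f'' cancel because the y-derivative of
  \<open>f\<close> is i f', and the mixed derivatives of \<open>u\<close> cancel in pairs.\<close>

lemma harmonic_on_compose_holomorphic:
  assumes "harmonic_on S u" "f holomorphic_on T" "open T" "f ` T \<subseteq> S"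
  shows "harmonic_on T (\<lambda>z. u (f z))"
  using assms(1)
proof (rule harmonic_onE)
  fix ux uy uxx uxy uyx uyy
  assume d: "\<And>z. z \<in> S \<Longrightarrow> (u has_derivative (\<lambda>h. ux z * Re h + uy z * Im h)) (at z)"
      "\<And>z. z \<in> S \<Longrightarrow> (ux has_derivative (\<lambda>h. uxx z * Re h + uxy z * Im h)) (at z)"
      "\<And>z. z \<in> S \<Longrightarrow> (uy has_derivative (\<lambda>h. uyx z * Re h + uyy z * Im h)) (at z)"
      "\<And>z. z \<in> S \<Longrightarrow> uxx z + uyy z = 0"
    and c: "continuous_on S uxx" "continuous_on S uxy" "continuous_on S uyx" "continuous_on S uyy"
  define f1 where "f1 = deriv f"
  define f2 where "f2 = deriv f1"
  have f1: "(f has_field_derivative f1 z) (at z)" if "z \<in> T" for z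
    using assms(2,3) that unfolding f1_def by (rule holomorphic_derivI)
  have h1: "f1 holomorphic_on T" unfolding f1_def using assms(2,3) by (rule holomorphic_deriv)
  have f2: "(f1 has_field_derivative f2 z) (at z)" if "z \<in> T" for z
    using h1 assms(3) that unfolding f2_def by (rule holomorphic_derivI)
  have h2: "f2 holomorphic_on T" unfolding f2_def using h1 assms(3) by (rule holomorphic_deriv)
  have cf: "continuous_on T f" "continuous_on T f1" "continuous_on T f2"
    using assms(2) h1 h2 holomorphic_on_imp_continuous_on by blast+
  have df: "(f has_derivative (\<lambda>h. f1 z * h)) (at z)" "(f1 has_derivative (\<lambda>h. f2 z * h)) (at z)"
    if "z \<in> T" for z using f1[OF that] f2[OF that] unfolding has_field_derivative_def by auto
  have fS: "f z \<in> S" if "z \<in> T" for z using assms(4) that by auto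
  have comp: "((\<lambda>z. w (f z)) has_derivative (\<lambda>h. wx (f z) * Re (f1 z * h) + wy (f z) * Im (f1 z * h))) (at z)"
    if "z \<in> T" "\<And>z. z \<in> S \<Longrightarrow> (w has_derivative (\<lambda>h. wx z * Re h + wy z * Im h)) (at z)" for w wx wy z
    using has_derivative_compose[OF df(1)[OF that(1)] that(2)[OF fS[OF that(1)]]] .
  have re: "((\<lambda>z. Re (f1 z)) has_derivative (\<lambda>h. Re (f2 z * h))) (at z)"
    and im: "((\<lambda>z. Im (f1 z)) has_derivative (\<lambda>h. Im (f2 z * h))) (at z)" if "z \<in> T" for z
    using df(2)[OF that] by (rule has_derivative_Re, rule has_derivative_Im)
  have cc: "continuous_on T (\<lambda>z. w (f z))" if "continuous_on S w" for w :: "complex \<Rightarrow> real"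
    using that assms(4) by (auto intro: continuous_on_compose2 cf)
  have cu: "continuous_on S ux" "continuous_on S uy"
    using d(2,3) by (meson continuous_at_imp_continuous_on has_derivative_continuous)+
  \<comment> \<open>The first partials of u o f, where d/dy f = i f' accounts for the signs in
    \<open>?y\<close>; \<open>?A\<close>, \<open>?B\<close> are the partials of ux o f, and
    \<open>?C\<close>, \<open>?D\<close> those of uy o f.\<close>
  let ?x = "\<lambda>z. ux (f z) * Re (f1 z) + uy (f z) * Im (f1 z)"
  let ?y = "\<lambda>z. uy (f z) * Re (f1 z) - ux (f z) * Im (f1 z)"
  let ?A = "\<lambda>z. uxx (f z) * Re (f1 z) + uxy (f z) * Im (f1 z)"
  let ?B = "\<lambda>z. uxy (f z) * Re (f1 z) - uxx (f z) * Im (f1 z)"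
  let ?C = "\<lambda>z. uyx (f z) * Re (f1 z) + uyy (f z) * Im (f1 z)"
  let ?D = "\<lambda>z. uyy (f z) * Re (f1 z) - uyx (f z) * Im (f1 z)"
  let ?xx = "\<lambda>z. ?A z * Re (f1 z) + ux (f z) * Re (f2 z) + ?C z * Im (f1 z) + uy (f z) * Im (f2 z)"
  let ?xy = "\<lambda>z. ?B z * Re (f1 z) - ux (f z) * Im (f2 z) + ?D z * Im (f1 z) + uy (f z) * Re (f2 z)"
  let ?yx = "\<lambda>z. ?C z * Re (f1 z) + uy (f z) * Re (f2 z) - ?A z * Im (f1 z) - ux (f z) * Im (f2 z)"
  let ?yy = "\<lambda>z. ?D z * Re (f1 z) - uy (f z) * Im (f2 z) - ?B z * Im (f1 z) - ux (f z) * Re (f2 z)"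
  show ?thesis
  proof (rule harmonic_onI[where ux = ?x and uy = ?y and uxx = ?xx and uxy = ?xy and uyx = ?yx and uyy = ?yy])
    fix z assume z: "z \<in> T"
    show "((\<lambda>z. u (f z)) has_derivative (\<lambda>h. ?x z * Re h + ?y z * Im h)) (at z)"
      by (rule has_derivative_eq_rhs[OF comp[OF z d(1)]]) (auto simp: algebra_simps)
    note dx = comp[OF z d(2)] and dy = comp[OF z d(3)]
    show "(?x has_derivative (\<lambda>h. ?xx z * Re h + ?xy z * Im h)) (at z)"
      by (rule has_derivative_eq_rhs[OF has_derivative_add[OF has_derivative_mult[OF dx re[OF z]]
              has_derivative_mult[OF dy im[OF z]]]])
        (auto simp: algebra_simps)
    show "(?y has_derivative (\<lambda>h. ?yx z * Re h + ?yy z * Im h)) (at z)"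
      by (rule has_derivative_eq_rhs[OF has_derivative_diff[OF has_derivative_mult[OF dy re[OF z]]
              has_derivative_mult[OF dx im[OF z]]]])
        (auto simp: algebra_simps)
    show "?xx z + ?yy z = 0"
    proof -
      have e: "uyy (f z) = - uxx (f z)" using d(4)[OF fS[OF z]] by simp
      show ?thesis by (simp add: e algebra_simps)
    qed
  qed (intro continuous_intros cf cc c cu assms(3))+
qed

text \<open>The partials of \<open>u\<close> are Re g and - Im g, and the Cauchy-Riemann equations
  of \<open>g\<close> become Laplace's equation for \<open>u\<close>. With \<open>g\<close> = 1/z
  this covers ln |z| without choosing a branch of the logarithm.\<close>

lemma harmonic_on_if_complex_gradient:
  assumes "open S" "g holomorphic_on S"
    and "\<And>z. z \<in> S \<Longrightarrow> (u has_derivative (\<lambda>h. Re (g z * h))) (at z)"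
  shows "harmonic_on S u"
proof -
  define g1 where "g1 = deriv g"
  have d: "(g has_derivative (\<lambda>h. g1 z * h)) (at z)" if "z \<in> S" for z
    using holomorphic_derivI[OF assms(2,1) that] unfolding g1_def has_field_derivative_def .
  have c: "continuous_on S g1"
    unfolding g1_def using assms(1,2) holomorphic_deriv holomorphic_on_imp_continuous_on by blast
  show ?thesis
  proof (rule harmonic_onI[where ux = "\<lambda>z. Re (g z)" and uy = "\<lambda>z. - Im (g z)"
        and uxx = "\<lambda>z. Re (g1 z)" and uxy = "\<lambda>z. - Im (g1 z)" and uyx = "\<lambda>z. - Im (g1 z)"
        and uyy = "\<lambda>z. - Re (g1 z)"])
    fix z assume z: "z \<in> S"
    show "(u has_derivative (\<lambda>h. Re (g z) * Re h + - Im (g z) * Im h)) (at z)"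
      by (rule has_derivative_eq_rhs[OF assms(3)[OF z]]) auto
    show "((\<lambda>z. Re (g z)) has_derivative (\<lambda>h. Re (g1 z) * Re h + - Im (g1 z) * Im h)) (at z)"
      by (rule has_derivative_eq_rhs[OF has_derivative_Re[OF d[OF z]]]) auto
    show "((\<lambda>z. - Im (g z)) has_derivative (\<lambda>h. - Im (g1 z) * Re h + - Re (g1 z) * Im h)) (at z)"
      by (rule has_derivative_eq_rhs[OF has_derivative_minus[OF has_derivative_Im[OF d[OF z]]]]) auto
  qed (auto intro!: continuous_intros c assms(1))
qed

lemma harmonic_on_ln_cmod: "harmonic_on (- {0}) (\<lambda>z. ln (cmod z))"
proof (rule harmonic_on_if_complex_gradient[where g = inverse])
  fix z :: complex assume z: "z \<in> - {0}"
  have n: "(norm has_derivative (\<lambda>h. inner h (sgn z))) (at z)"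
    using z by (intro has_derivative_norm) auto
  show "((\<lambda>z. ln (cmod z)) has_derivative (\<lambda>h. Re (inverse z * h))) (at z)"
  proof (rule has_derivative_eq_rhs[OF has_derivative_ln[OF _ n]])
    show "(\<lambda>h. inner h (sgn z) * inverse (cmod z)) = (\<lambda>h. Re (inverse z * h))"
      using z by (auto simp: fun_eq_iff inner_complex_def sgn_div_norm divide_simps cmod_power2
          power2_eq_square[symmetric] Re_divide Im_divide)
  qed (use z in auto)
qed (auto intro!: holomorphic_intros)


section \<open>A minimum principle with a countable exceptional set\<close>

text \<open>If \<open>D\<close> were negative, \<open>\<phi>'\<close> would vanish at 0 and be
  negative just to the right of it, and the mean value theorem would produce a value below the
  minimum.\<close>

lemma second_derivative_nonneg_at_min:
  fixes \<phi> \<phi>' :: "real \<Rightarrow> real"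
  assumes "0 < r"
    and d: "\<And>t. \<bar>t\<bar> < r \<Longrightarrow> (\<phi> has_real_derivative \<phi>' t) (at t)"
    and d2: "(\<phi>' has_real_derivative D) (at 0)"
    and min: "\<And>t. \<bar>t\<bar> < r \<Longrightarrow> \<phi> 0 \<le> \<phi> t"
  shows "0 \<le> D"
proof (rule ccontr)
  assume "\<not> 0 \<le> D"
  then obtain e where e: "0 < e" "\<And>h. 0 < h \<Longrightarrow> h < e \<Longrightarrow> \<phi>' (0 + h) < \<phi>' 0"
    using DERIV_neg_dec_right[OF d2] by auto
  have 0: "\<phi>' 0 = 0"
    using DERIV_local_min[OF d[of 0] \<open>0 < r\<close>] min \<open>0 < r\<close> by auto
  define t where "t = min e r / 2"
  have t: "0 < t" "t < e" "t < r" using e \<open>0 < r\<close> unfolding t_def by auto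
  obtain x where x: "0 < x" "x < t" "\<phi> t - \<phi> 0 = (t - 0) * \<phi>' x"
    using MVT2[of 0 t \<phi> \<phi>'] t d by (metis abs_of_nonneg order_le_less_trans)
  have "\<phi>' x < 0" using e(2)[of x] x t 0 by simp
  then have "\<phi> t < \<phi> 0" using x(3) t(1) mult_pos_neg[of t "\<phi>' x"] by simp
  with min[of t] t show False by simp
qed

text \<open>The Laplacian of \<open>h(z) - \<eta> |z|\<^sup>2\<close> is \<open>- 4 \<eta>\<close>, which the second derivative test forbids
  at a local minimum.\<close>

lemma harmonic_on_perturbed_no_min:
  assumes "harmonic_on (ball z r) h" "0 < r" "0 < \<eta>"
    and min: "\<And>w. w \<in> ball z r \<Longrightarrow> h z - \<eta> * (cmod z)\<^sup>2 \<le> h w - \<eta> * (cmod w)\<^sup>2"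
  shows False
  using assms(1)
proof (rule harmonic_onE)
  fix ux uy uxx uxy uyx uyy
  assume d: "\<And>w. w \<in> ball z r \<Longrightarrow> (h has_derivative (\<lambda>k. ux w * Re k + uy w * Im k)) (at w)"
      "\<And>w. w \<in> ball z r \<Longrightarrow> (ux has_derivative (\<lambda>k. uxx w * Re k + uxy w * Im k)) (at w)"
      "\<And>w. w \<in> ball z r \<Longrightarrow> (uy has_derivative (\<lambda>k. uyx w * Re k + uyy w * Im k)) (at w)"
      "\<And>w. w \<in> ball z r \<Longrightarrow> uxx w + uyy w = 0"
  \<comment> \<open>Partial derivatives as real derivatives along the horizontal line through
    \<open>z\<close>; \<open>ly\<close> is the vertical counterpart.\<close>
  have lx: "((\<lambda>t. v (z + complex_of_real t)) has_real_derivative a) (at t)"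
    if "(v has_derivative (\<lambda>k. a * Re k + b * Im k)) (at (z + complex_of_real t))" for v a b t
  proof -
    have "((\<lambda>t. z + complex_of_real t) has_derivative (\<lambda>k. complex_of_real k)) (at t)"
      by (auto intro!: derivative_eq_intros)
    from has_derivative_compose[OF this that] show ?thesis
      by (simp add: has_field_derivative_def)
  qed
  have ly: "((\<lambda>t. v (z + \<i> * complex_of_real t)) has_real_derivative b) (at t)"
    if "(v has_derivative (\<lambda>k. a * Re k + b * Im k)) (at (z + \<i> * complex_of_real t))" for v a b t
  proof -
    have "((\<lambda>t. z + \<i> * complex_of_real t) has_derivative (\<lambda>k. \<i> * complex_of_real k)) (at t)"
      by (auto intro!: derivative_eq_intros)
    from has_derivative_compose[OF this that] show ?thesis
      by (simp add: has_field_derivative_def)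
  qed
  have bx: "z + complex_of_real t \<in> ball z r" "z + \<i> * complex_of_real t \<in> ball z r" if "\<bar>t\<bar> < r" for t
    using that by (auto simp: dist_norm norm_mult)
  have "0 \<le> uxx z - 2 * \<eta>"
  proof (rule second_derivative_nonneg_at_min[OF \<open>0 < r\<close>])
    fix t assume t: "\<bar>t\<bar> < r"
    show "((\<lambda>t. h (z + complex_of_real t) - \<eta> * ((Re z + t)\<^sup>2 + (Im z)\<^sup>2)) has_real_derivative
        ux (z + complex_of_real t) - 2 * \<eta> * (Re z + t)) (at t)"
      by (rule derivative_eq_intros lx[OF d(1)[OF bx(1)[OF t]]] refl | simp)+
    show "h (z + complex_of_real 0) - \<eta> * ((Re z + 0)\<^sup>2 + (Im z)\<^sup>2)
       \<le> h (z + complex_of_real t) - \<eta> * ((Re z + t)\<^sup>2 + (Im z)\<^sup>2)"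
      using min[OF bx(1)[OF t]] by (simp add: cmod_power2)
  next
    show "((\<lambda>t. ux (z + complex_of_real t) - 2 * \<eta> * (Re z + t)) has_real_derivative uxx z - 2 * \<eta>) (at 0)"
    proof -
      have "((\<lambda>t. ux (z + complex_of_real t)) has_real_derivative uxx z) (at 0)"
        using lx[of ux "uxx z" "uxy z" 0] d(2)[of z] \<open>0 < r\<close> by simp
      then show ?thesis by (auto intro!: derivative_eq_intros)
    qed
  qed
  moreover have "0 \<le> uyy z - 2 * \<eta>"
  proof (rule second_derivative_nonneg_at_min[OF \<open>0 < r\<close>])
    fix t assume t: "\<bar>t\<bar> < r"
    show "((\<lambda>t. h (z + \<i> * complex_of_real t) - \<eta> * ((Re z)\<^sup>2 + (Im z + t)\<^sup>2)) has_real_derivative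
        uy (z + \<i> * complex_of_real t) - 2 * \<eta> * (Im z + t)) (at t)"
      by (rule derivative_eq_intros ly[OF d(1)[OF bx(2)[OF t]]] refl | simp)+
    show "h (z + \<i> * complex_of_real 0) - \<eta> * ((Re z)\<^sup>2 + (Im z + 0)\<^sup>2)
       \<le> h (z + \<i> * complex_of_real t) - \<eta> * ((Re z)\<^sup>2 + (Im z + t)\<^sup>2)"
      using min[OF bx(2)[OF t]] by (simp add: cmod_power2)
  next
    show "((\<lambda>t. uy (z + \<i> * complex_of_real t) - 2 * \<eta> * (Im z + t)) has_real_derivative uyy z - 2 * \<eta>) (at 0)"
    proof -
      have "((\<lambda>t. uy (z + \<i> * complex_of_real t)) has_real_derivative uyy z) (at 0)"
        using ly[of uy "uyx z" "uyy z" 0] d(3)[of z] \<open>0 < r\<close> by simp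
      then show ?thesis by (auto intro!: derivative_eq_intros)
    qed
  qed
  ultimately show False using d(4)[of z] assms(2,3) by auto
qed

text \<open>Distinct points receive distinct terms of the series of 2^-(n+1). The bound has to be
  uniform in \<open>F\<close>, because the weights determine the radii of a cover before compactness
  selects \<open>F\<close>.\<close>

lemma sum_countable_weights_le_1:
  assumes "countable C" "finite F" "F \<subseteq> C"
  shows "(\<Sum>x\<in>F. (1/2::real) ^ Suc (to_nat_on C x)) \<le> 1"
proof -
  have inj: "inj_on (to_nat_on C) F"
    using inj_on_to_nat_on[OF assms(1)] assms(3) inj_on_subset by blast
  have "(\<Sum>x\<in>F. (1/2::real) ^ Suc (to_nat_on C x)) = (\<Sum>n\<in>to_nat_on C ` F. (1/2) ^ Suc n)"
    by (simp add: sum.reindex[OF inj])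
  also have "\<dots> \<le> (\<Sum>n. (1/2::real) ^ Suc n)"
    using assms(2) by (intro sum_le_suminf sums_summable[OF power_half_series]) auto
  also have "\<dots> = 1" using power_half_series sums_unique by fastforce
  finally show ?thesis .
qed

text \<open>The logarithmic potential \<open>p\<close> of finitely many points of \<open>C\<close> makes the boundary values of
  \<open>u + \<epsilon> p - (1 - 2 \<epsilon>) s\<close> nonnegative near \<open>C\<close>; compactness of \<open>E\<close> makes finitely many points
  suffice, and their weights have total mass at most 1, which leaves the term \<open>\<epsilon> ln \<bar>z\<bar>\<close> to control infinity.\<close>

lemma comparison_exceptional_set_eps:
  fixes E K C :: "complex set" and u s :: "complex \<Rightarrow> real"
  assumes "compact E" and E: "E = K \<union> C" and "countable C"
    and u_harm: "\<And>z. z \<notin> E \<Longrightarrow> \<exists>r>0. harmonic_on (ball z r) u"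
    and u_pos: "\<And>z. z \<notin> E \<Longrightarrow> 0 < u z"
    and u_inf: "\<And>z. R0 \<le> cmod z \<Longrightarrow> ln (cmod z) - B0 \<le> u z"
    and s_cont: "continuous_on UNIV s" and s_nonneg: "\<And>z. 0 \<le> s z"
    and s_K: "\<And>z. z \<in> K \<Longrightarrow> s z = 0"
    and s_harm: "harmonic_on {z. 0 < s z} s"
    and s_inf: "\<And>z. R1 \<le> cmod z \<Longrightarrow> s z \<le> ln (cmod z) + B1"
    and \<rho>: "1 \<le> \<rho>" "E \<subseteq> ball 0 \<rho>" "{z. s z = 0} \<subseteq> ball 0 \<rho>"
    and \<epsilon>: "0 < \<epsilon>" "\<epsilon> < 1/2"
    and z0: "z0 \<notin> E" and d0: "0 < d0" "\<And>x. x \<in> E \<Longrightarrow> d0 \<le> cmod (z0 - x)"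
  shows "(1 - 2 * \<epsilon>) * s z0 - \<epsilon> * \<bar>ln (2 * \<rho> / d0)\<bar> - \<epsilon> \<le> u z0"
proof -
  \<comment> \<open>Twice the radius, so that ln M - ln |z - x| is nonnegative for \<open>z\<close>
    and \<open>x\<close> in the ball.\<close>
  define M where "M = 2 * \<rho>"
  have M: "0 < M" using \<rho> unfolding M_def by simp
  have "compact (s ` cball 0 \<rho>)"
    by (intro compact_continuous_image continuous_on_subset[OF s_cont]) auto
  then obtain S0 where S0: "\<And>z. z \<in> cball 0 \<rho> \<Longrightarrow> norm (s z) \<le> S0"
    using compact_imp_bounded bounded_iff by (metis imageI)
  define S where "S = max S0 1"
  have S: "0 < S" "s z \<le> S" if "z \<in> ball 0 \<rho>" for z
    using S0[of z] that unfolding S_def by auto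
  define m where "m x = (1/2::real) ^ Suc (to_nat_on C x)" for x
  have m: "0 < m x" for x unfolding m_def by simp
  \<comment> \<open>Solves \<epsilon> m(x) (ln M - ln r) = S: within this distance of
    \<open>x\<close>, its own term of the potential already outweighs \<open>s\<close>.\<close>
  define r where "r x = M * exp (- S / (\<epsilon> * m x))" for x
  have r: "0 < r x" for x unfolding r_def using M by simp
  have near: "S \<le> \<epsilon> * (m x * (ln M - ln (cmod (z - x))))" if "cmod (z - x) < r x" "z \<noteq> x" for z x
  proof -
    have "ln (cmod (z - x)) \<le> ln (r x)" using that r[of x] by (subst ln_le_cancel_iff) auto
    also have "ln (r x) = ln M - S / (\<epsilon> * m x)"
      unfolding r_def using M by (simp add: ln_mult)
    finally have "S / (\<epsilon> * m x) \<le> ln M - ln (cmod (z - x))" by simp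
    then show ?thesis using m[of x] \<epsilon> by (simp add: field_simps)
  qed
  \<comment> \<open>\<open>V\<close> takes care of \<open>K\<close>, where \<open>s\<close>
    vanishes; the rest of \<open>E\<close> is a compact subset of \<open>C\<close>.\<close>
  define V where "V = {z. s z < \<epsilon>}"
  have "open V" unfolding V_def using s_cont by (intro open_Collect_less) auto
  have "E - V \<subseteq> C" using E s_K \<epsilon>(1) unfolding V_def by auto
  moreover have "compact (E - V)" using \<open>compact E\<close> \<open>open V\<close> by (rule compact_diff)
  moreover have "E - V \<subseteq> (\<Union>x\<in>C. ball x (r x))" using \<open>E - V \<subseteq> C\<close> r by force
  ultimately have cover: "compact (E - V)" "E - V \<subseteq> (\<Union>x\<in>C. ball x (r x))" by auto
  obtain F where "F \<subseteq> C" "finite F" "E - V \<subseteq> (\<Union>x\<in>F. ball x (r x))"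
    by (rule compactE_image[OF cover(1) _ cover(2)]) auto
  then have F: "finite F" "F \<subseteq> C" "E - V \<subseteq> (\<Union>x\<in>F. ball x (r x))" by auto
  have FE: "F \<subseteq> E" using F E by auto
  define p where "p z = (\<Sum>x\<in>F. m x * (ln M - ln (cmod (z - x))))" for z
  have sum_m: "sum m F \<le> 1"
    unfolding m_def using sum_countable_weights_le_1[OF \<open>countable C\<close> F(1,2)] .
  have term_nonneg: "0 \<le> m x * (ln M - ln (cmod (z - x)))" if "z \<in> ball 0 \<rho>" "z \<notin> E" "x \<in> F" for z x
  proof -
    have "cmod (z - x) \<le> cmod z + cmod x" by (rule norm_triangle_ineq4)
    also have "\<dots> \<le> M" using that FE \<rho>(2) unfolding M_def by force
    finally have "ln (cmod (z - x)) \<le> ln M" using that FE M by (subst ln_le_cancel_iff) auto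
    then show ?thesis using m[of x] by simp
  qed
  have p_nonneg: "0 \<le> p z" if "z \<in> ball 0 \<rho>" "z \<notin> E" for z
    unfolding p_def using term_nonneg that by (intro sum_nonneg) auto
  have p_z0: "p z0 \<le> \<bar>ln (M / d0)\<bar>"
  proof -
    have "p z0 \<le> (\<Sum>x\<in>F. m x * \<bar>ln (M / d0)\<bar>)"
      unfolding p_def
    proof (intro sum_mono mult_left_mono)
      fix x assume "x \<in> F"
      then have "ln d0 \<le> ln (cmod (z0 - x))"
        using d0 FE z0 by (subst ln_le_cancel_iff) auto
      then show "ln M - ln (cmod (z0 - x)) \<le> \<bar>ln (M / d0)\<bar>"
        using M d0 by (simp add: ln_div)
    qed (use m in \<open>simp add: less_imp_le\<close>)
    also have "\<dots> = sum m F * \<bar>ln (M / d0)\<bar>" by (simp add: sum_distrib_right)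
    also have "\<dots> \<le> 1 * \<bar>ln (M / d0)\<bar>" by (intro mult_right_mono sum_m) auto
    finally show ?thesis by simp
  qed
  \<comment> \<open>With |z - x| \<le> 2 |z| and 2 \<le> M each difference of logarithms is at least
    - ln |z|, and the weights sum to at most 1.\<close>
  have p_lower: "- ln (cmod z) \<le> p z" if "\<rho> \<le> cmod z" "z \<notin> E" for z
  proof -
    have z1: "1 \<le> cmod z" using that \<rho> by simp
    have "- ln (cmod z) \<le> - (sum m F * ln (cmod z))"
      using mult_right_mono[OF sum_m, of "ln (cmod z)"] z1 by simp
    also have "\<dots> = (\<Sum>x\<in>F. m x * (- ln (cmod z)))"
      by (simp add: sum_distrib_right sum_negf)
    also have "\<dots> \<le> p z"
      unfolding p_def
    proof (intro sum_mono mult_left_mono)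
      fix x assume x: "x \<in> F"
      have "cmod (z - x) \<le> cmod z + cmod x" by (rule norm_triangle_ineq4)
      also have "\<dots> \<le> 2 * cmod z" using x FE \<rho>(2) that by force
      finally have "ln (cmod (z - x)) \<le> ln (2 * cmod z)"
        using x FE that by (subst ln_le_cancel_iff) auto
      also have "\<dots> = ln 2 + ln (cmod z)" using z1 by (subst ln_mult) auto
      also have "\<dots> \<le> ln M + ln (cmod z)" using \<rho>(1) unfolding M_def by simp
      finally show "- ln (cmod z) \<le> ln M - ln (cmod (z - x))" by simp
    qed (use m in \<open>simp add: less_imp_le\<close>)
    finally show ?thesis .
  qed
  \<comment> \<open>One \<epsilon> of the factor 1 - 2 \<epsilon> pays for the growth of
    \<open>\<epsilon> * p\<close>; the other leaves \<open>h\<close> at least \<epsilon> ln |z|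
    minus a constant at infinity.\<close>
  define h where "h z = u z + \<epsilon> * p z + - (1 - 2 * \<epsilon>) * s z" for z
  \<comment> \<open>The bound is -\<epsilon> and not 0 because \<open>s\<close> may come close to
    \<epsilon> on \<open>V\<close>.\<close>
  have "- \<epsilon> \<le> h z0"
  proof (rule ccontr)
    assume neg: "\<not> - \<epsilon> \<le> h z0"
    \<comment> \<open>The last entry gives |B0| + |B1| \<le> \<epsilon> ln R, which makes
      \<open>h\<close> nonnegative on the circle of radius \<open>R\<close>.\<close>
    define R where "R = Max {R0, R1, \<rho>, cmod z0 + 1, exp ((\<bar>B0\<bar> + \<bar>B1\<bar>) / \<epsilon>)}"
    have "x \<le> R" if "x \<in> {R0, R1, \<rho>, cmod z0 + 1, exp ((\<bar>B0\<bar> + \<bar>B1\<bar>) / \<epsilon>)}" for x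
      unfolding R_def using that by (intro Max_ge) blast+
    from this[of R0] this[of R1] this[of \<rho>] this[of "cmod z0 + 1"] this[of "exp ((\<bar>B0\<bar> + \<bar>B1\<bar>) / \<epsilon>)"]
    have R: "R0 \<le> R" "R1 \<le> R" "\<rho> \<le> R" "cmod z0 < R" "exp ((\<bar>B0\<bar> + \<bar>B1\<bar>) / \<epsilon>) \<le> R"
      by simp_all
    have Rpos: "1 \<le> R" using R \<rho> by simp
    have h_R: "0 \<le> h z" if "cmod z = R" "z \<notin> E" for z
    proof -
      have "(\<bar>B0\<bar> + \<bar>B1\<bar>) / \<epsilon> \<le> ln R" using R(5) Rpos by (simp add: ln_ge_iff)
      then have a: "\<bar>B0\<bar> + \<bar>B1\<bar> \<le> \<epsilon> * ln R" using \<epsilon> by (simp add: field_simps)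
      have "\<epsilon> * (- ln R) \<le> \<epsilon> * p z" using p_lower[of z] that R \<epsilon> by (intro mult_left_mono) auto
      moreover have "(1 - 2 * \<epsilon>) * s z \<le> (1 - 2 * \<epsilon>) * (ln R + B1)"
        using s_inf[of z] that R \<epsilon> by (intro mult_left_mono) auto
      moreover have "ln R - B0 \<le> u z" using u_inf[of z] that R by auto
      moreover have "(1 - 2 * \<epsilon>) * B1 \<le> \<bar>B1\<bar>"
      proof -
        have "(1 - 2 * \<epsilon>) * B1 \<le> (1 - 2 * \<epsilon>) * \<bar>B1\<bar>" using \<epsilon> by (intro mult_left_mono) auto
        also have "\<dots> \<le> 1 * \<bar>B1\<bar>" using \<epsilon> by (intro mult_right_mono) auto
        finally show ?thesis by simp
      qed
      ultimately show ?thesis using a abs_ge_self[of B0] unfolding h_def by (simp add: algebra_simps)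
    qed
    \<comment> \<open>An open neighbourhood of \<open>E\<close> on which, outside \<open>E\<close>,
      the bound -\<epsilon> already holds. Removing it keeps the minimum away from \<open>E\<close>,
      where \<open>u\<close> is uncontrolled.\<close>
    define W where "W = ball 0 \<rho> \<inter> (V \<union> (\<Union>x\<in>F. ball x (r x)))"
    have "open W" unfolding W_def using \<open>open V\<close> by auto
    have EW: "E \<subseteq> W" unfolding W_def using F(3) \<rho>(2) by auto
    have h_W: "- \<epsilon> \<le> h z" if "z \<in> W" "z \<notin> E" for z
    proof (cases "z \<in> V")
      case True
      have "(1 - 2 * \<epsilon>) * s z \<le> 1 * s z" using \<epsilon> s_nonneg by (intro mult_right_mono) auto
      also have "\<dots> < \<epsilon>" using True unfolding V_def by simp
      finally have "(1 - 2 * \<epsilon>) * s z < \<epsilon>" .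
      moreover have "0 \<le> \<epsilon> * p z"
        using p_nonneg[of z] that \<epsilon> by (intro mult_nonneg_nonneg) (auto simp: W_def)
      ultimately show ?thesis
        using u_pos[OF that(2)] unfolding h_def mult_minus_left by linarith
    next
      case False
      with that(1) obtain x where x: "x \<in> F" "z \<in> ball x (r x)" unfolding W_def by blast
      have "S \<le> \<epsilon> * (m x * (ln M - ln (cmod (z - x))))"
        using x that FE by (intro near) (auto simp: dist_norm norm_minus_commute)
      also have "\<dots> \<le> \<epsilon> * p z"
        unfolding p_def using \<epsilon> that F(1) term_nonneg x
        by (intro mult_left_mono member_le_sum) (auto simp: W_def)
      finally have "S \<le> \<epsilon> * p z" .
      moreover have "(1 - 2 * \<epsilon>) * s z \<le> 1 * s z" using \<epsilon> s_nonneg by (intro mult_right_mono) auto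
      moreover have "s z \<le> S" using that S unfolding W_def by auto
      ultimately show ?thesis
        using u_pos[OF that(2)] \<epsilon>(1) unfolding h_def mult_minus_left by linarith
    qed
    \<comment> \<open>\<open>s\<close> is known to be harmonic only where it is positive, so its
      zero set must be ruled out as the place of the minimum.\<close>
    have h_0: "0 \<le> h z" if "s z = 0" "z \<notin> E" for z
      using u_pos[of z] p_nonneg[of z] that \<rho>(3) \<epsilon> unfolding h_def by auto
    \<comment> \<open>So small that the perturbation \<eta> |z|^2, at most \<eta> R^2 on the disc,
      uses up less than the gap between \<open>h z0\<close> and -\<epsilon>.\<close>
    define \<eta> where "\<eta> = (- \<epsilon> - h z0) / (R\<^sup>2 + 1)"
    have "0 < R\<^sup>2 + 1" by (smt (verit) zero_le_power2)
    have \<eta>: "0 < \<eta>" "\<eta> * R\<^sup>2 < - \<epsilon> - h z0"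
    proof -
      show "0 < \<eta>" unfolding \<eta>_def using neg \<open>0 < R\<^sup>2 + 1\<close> by (intro divide_pos_pos) auto
      have "\<eta> * R\<^sup>2 < \<eta> * (R\<^sup>2 + 1)" using \<open>0 < \<eta>\<close> by simp
      also have "\<dots> = - \<epsilon> - h z0" unfolding \<eta>_def using \<open>0 < R\<^sup>2 + 1\<close> by simp
      finally show "\<eta> * R\<^sup>2 < - \<epsilon> - h z0" .
    qed
    have h_harm: "harmonic_on (ball z r') h"
      if "harmonic_on (ball z r') u" "ball z r' \<inter> E = {}" "ball z r' \<subseteq> {z. 0 < s z}" for z r'
    proof -
      have "harmonic_on (ball z r') (\<lambda>z. m x * (ln M + (-1) * ln (cmod (z - x))))" if "x \<in> F" for x
      proof (intro harmonic_on_cmult harmonic_on_add harmonic_on_const open_ball)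
        show "harmonic_on (ball z r') (\<lambda>z. ln (cmod (z - x)))"
          by (rule harmonic_on_compose_holomorphic[OF harmonic_on_ln_cmod])
            (use that FE \<open>ball z r' \<inter> E = {}\<close> in \<open>auto intro!: holomorphic_intros\<close>)
      qed
      then have "harmonic_on (ball z r') p"
        unfolding p_def by (intro harmonic_on_sum F) auto
      then show ?thesis
        unfolding h_def
        by (intro harmonic_on_add harmonic_on_cmult that(1) harmonic_on_subset[OF s_harm open_ball that(3)])
    qed
    define k where "k z = h z - \<eta> * (cmod z)\<^sup>2" for z
    have u_cont: "isCont u z" if zE: "z \<notin> E" for z
    proof -
      obtain r' where "0 < r'" "harmonic_on (ball z r') u" using u_harm[OF zE] by blast
      then show ?thesis
        using harmonic_on_imp_continuous_on continuous_on_interior by fastforce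
    qed
    have k_cont: "continuous_on (- E) k"
      unfolding k_def h_def p_def
      using s_cont FE u_cont
      by (intro continuous_intros) (auto intro: continuous_on_subset continuous_at_imp_continuous_on)
    define Q where "Q = cball 0 R - W"
    have "compact Q" unfolding Q_def using \<open>open W\<close> by (intro compact_diff) auto
    moreover have "z0 \<in> Q" unfolding Q_def using R h_W[OF _ z0] neg by auto
    moreover have "continuous_on Q k"
      by (rule continuous_on_subset[OF k_cont]) (use EW in \<open>auto simp: Q_def\<close>)
    ultimately obtain z1 where z1: "z1 \<in> Q" "\<And>z. z \<in> Q \<Longrightarrow> k z1 \<le> k z"
      using continuous_attains_inf[of Q k] by auto
    have sq: "\<eta> * (cmod z)\<^sup>2 \<le> \<eta> * R\<^sup>2" if "cmod z \<le> R" for z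
      using that \<eta>(1) by (intro mult_left_mono power_mono) auto
    have z1E: "z1 \<notin> E" using z1(1) EW unfolding Q_def by auto
    have kz1: "k z1 < - \<epsilon> - \<eta> * R\<^sup>2"
    proof -
      have "k z1 \<le> k z0" using z1(2)[OF \<open>z0 \<in> Q\<close>] .
      also have "\<dots> \<le> h z0" unfolding k_def using \<eta>(1) by simp
      finally show ?thesis using \<eta>(2) by simp
    qed
    have hz1: "h z1 < - \<epsilon>"
      using kz1 sq[of z1] z1(1) unfolding k_def Q_def by auto
    have "cmod z1 \<noteq> R" using h_R[OF _ z1E] hz1 \<epsilon> by auto
    then have z1R: "z1 \<in> ball 0 R" using z1(1) unfolding Q_def by auto
    have "s z1 \<noteq> 0" using h_0[OF _ z1E] hz1 \<epsilon> by auto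
    then have z1s: "z1 \<in> {z. 0 < s z}" using s_nonneg[of z1] by simp
    \<comment> \<open>The minimum over the compact set \<open>Q\<close> is also one over the disc
      minus \<open>E\<close>, so a whole ball around \<open>z1\<close> is available for the second
      derivative test.\<close>
    have k_min: "k z1 \<le> k z" if "z \<in> ball 0 R - E" for z
    proof (cases "z \<in> W")
      case True
      then have "- \<epsilon> - \<eta> * R\<^sup>2 \<le> k z" using h_W[of z] sq[of z] that unfolding k_def by auto
      then show ?thesis using kz1 by simp
    next
      case False
      then show ?thesis using z1(2)[of z] that unfolding Q_def by auto
    qed
    obtain r1 where r1: "0 < r1" "harmonic_on (ball z1 r1) u" using u_harm[OF z1E] by blast
    have "open (ball 0 R \<inter> {z. 0 < s z} \<inter> (- E))"
      using \<open>compact E\<close> compact_imp_closed s_cont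
      by (intro open_Int open_Collect_less open_Compl) auto
    then obtain r2 where r2: "0 < r2" "ball z1 r2 \<subseteq> ball 0 R \<inter> {z. 0 < s z} \<inter> (- E)"
      using z1R z1s z1E open_contains_ball by blast
    define r3 where "r3 = min r1 r2"
    have r3: "0 < r3" "ball z1 r3 \<subseteq> ball z1 r1" "ball z1 r3 \<subseteq> ball z1 r2"
      using r1 r2 unfolding r3_def by auto
    have "harmonic_on (ball z1 r3) h"
      using r3 r2 by (intro h_harm harmonic_on_subset[OF r1(2)]) auto
    then show False
      using harmonic_on_perturbed_no_min[OF _ r3(1) \<eta>(1)] k_min r3 r2 unfolding k_def by blast
  qed
  moreover have "\<epsilon> * p z0 \<le> \<epsilon> * \<bar>ln (M / d0)\<bar>" using p_z0 \<epsilon> by (intro mult_left_mono) auto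
  ultimately show ?thesis unfolding h_def M_def mult_minus_left by linarith
qed

text \<open>For fixed \<open>z0\<close> the loss in the previous estimate is \<epsilon> times a
  constant, so \<epsilon> may tend to 0 even though the finite set of poles changes with it.\<close>

lemma comparison_exceptional_set:
  fixes E K C :: "complex set" and u s :: "complex \<Rightarrow> real"
  assumes "compact E" and E: "E = K \<union> C" and "countable C"
    and u_harm: "\<And>z. z \<notin> E \<Longrightarrow> \<exists>r>0. harmonic_on (ball z r) u"
    and u_pos: "\<And>z. z \<notin> E \<Longrightarrow> 0 < u z"
    and u_inf: "\<And>z. R0 \<le> cmod z \<Longrightarrow> ln (cmod z) - B0 \<le> u z"
    and s_cont: "continuous_on UNIV s" and s_nonneg: "\<And>z. 0 \<le> s z"
    and s_K: "\<And>z. z \<in> K \<Longrightarrow> s z = 0" and s_bdd: "bounded {z. s z = 0}"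
    and s_harm: "harmonic_on {z. 0 < s z} s"
    and s_inf: "\<And>z. R1 \<le> cmod z \<Longrightarrow> s z \<le> ln (cmod z) + B1"
    and z0: "z0 \<notin> E"
  shows "s z0 \<le> u z0"
proof -
  have "bounded (E \<union> {z. s z = 0})"
    using s_bdd \<open>compact E\<close> compact_imp_bounded by auto
  then obtain \<rho>0 where \<rho>0: "E \<union> {z. s z = 0} \<subseteq> ball 0 \<rho>0"
    using bounded_subset_ballD by blast
  define \<rho> where "\<rho> = max 1 \<rho>0"
  have \<rho>: "1 \<le> \<rho>" "E \<subseteq> ball 0 \<rho>" "{z. s z = 0} \<subseteq> ball 0 \<rho>"
    using \<rho>0 unfolding \<rho>_def by auto
  obtain d0 where d0: "0 < d0" "\<And>x. x \<in> E \<Longrightarrow> d0 \<le> cmod (z0 - x)"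
    using separate_point_closed[OF compact_imp_closed[OF \<open>compact E\<close>] z0] by (auto simp: dist_norm)
  define A where "A = 2 * s z0 + \<bar>ln (2 * \<rho> / d0)\<bar> + 1"
  have A: "0 < A" using s_nonneg[of z0] unfolding A_def by simp
  show ?thesis
  proof (rule field_le_epsilon)
    fix e :: real assume e: "0 < e"
    define \<epsilon> where "\<epsilon> = min (e / A) (1/4)"
    have \<epsilon>: "0 < \<epsilon>" "\<epsilon> < 1/2" "\<epsilon> * A \<le> e"
    proof -
      show "0 < \<epsilon>" using e A unfolding \<epsilon>_def by simp
      have "\<epsilon> * A \<le> e / A * A" using A unfolding \<epsilon>_def by (intro mult_right_mono) auto
      then show "\<epsilon> * A \<le> e" using A by simp
      have "\<epsilon> \<le> 1/4" unfolding \<epsilon>_def by (rule min.cobounded2)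
      then show "\<epsilon> < 1/2" by simp
    qed
    have "(1 - 2 * \<epsilon>) * s z0 - \<epsilon> * \<bar>ln (2 * \<rho> / d0)\<bar> - \<epsilon> \<le> u z0"
      by (rule comparison_exceptional_set_eps[OF assms(1-9) s_harm s_inf \<rho> \<epsilon>(1,2) z0 d0])
    then have "s z0 - \<epsilon> * A \<le> u z0" unfolding A_def by (simp add: algebra_simps)
    then show "s z0 \<le> u z0 + e" using \<epsilon>(3) by simp
  qed
qed


section \<open>The Green function of an interval\<close>

lemma arcosh_le_ln:
  fixes A :: real assumes "1 \<le> A" shows "arcosh A \<le> ln (2 * A)"
proof -
  have "sqrt (A\<^sup>2 - 1) \<le> A" using assms by (intro real_le_lsqrt) auto
  moreover have "0 \<le> sqrt (A\<^sup>2 - 1)" using assms by simp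
  ultimately have "ln (A + sqrt (A\<^sup>2 - 1)) \<le> ln (2 * A)"
    using assms by (subst ln_le_cancel_iff) linarith+
  then show ?thesis using assms by (simp add: arcosh_real_def)
qed

text \<open>With v = sqrt (A - 1), arcosh A is at least ln (1 + v), hence at least v / (1 + v); and
  A \<le> 2 means v \<le> 1.\<close>

lemma arcosh_ge_sqrt:
  fixes A :: real assumes "1 \<le> A" "A \<le> 2" shows "sqrt (A - 1) / 2 \<le> arcosh A"
proof -
  define v where "v = sqrt (A - 1)"
  have v: "0 \<le> v" "v \<le> 1" using assms unfolding v_def by auto
  have "v \<le> sqrt (A\<^sup>2 - 1)"
    unfolding v_def using self_le_power[of A 2] assms by (intro real_sqrt_le_mono) simp
  then have "ln (1 + v) \<le> ln (A + sqrt (A\<^sup>2 - 1))"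
    using assms v by (subst ln_le_cancel_iff) linarith+
  moreover have "v / (1 + v) \<le> ln (1 + v)"
  proof -
    have "- ln (1 + v) \<le> inverse (1 + v) - 1"
      using ln_le_minus_one[of "inverse (1 + v)"] v unfolding ln_inverse by simp
    then show ?thesis using v by (simp add: divide_simps split: if_splits)
  qed
  moreover have "v / 2 \<le> v / (1 + v)" using v by (intro divide_left_mono) auto
  ultimately show ?thesis unfolding arcosh_real_def[OF assms(1)] v_def[symmetric] by linarith
qed

text \<open>By ln t \<le> t - 1, arcosh A is at most (A - 1) + sqrt (A + 1) sqrt (A - 1), and each
  summand is at most sqrt (N + 1) sqrt (A - 1).\<close>

lemma arcosh_le_sqrt:
  fixes A :: real assumes "1 \<le> A" "A \<le> N" shows "arcosh A \<le> 2 * sqrt (N + 1) * sqrt (A - 1)"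
proof -
  have "arcosh A = ln (A + sqrt (A\<^sup>2 - 1))" using assms by (simp add: arcosh_real_def)
  also have "\<dots> \<le> (A - 1) + sqrt (A\<^sup>2 - 1)"
    using ln_le_minus_one[of "A + sqrt (A\<^sup>2 - 1)"] assms by (smt (verit) one_le_power real_sqrt_ge_zero)
  also have "sqrt (A\<^sup>2 - 1) = sqrt (A + 1) * sqrt (A - 1)"
    by (simp add: real_sqrt_mult[symmetric] power2_eq_square algebra_simps)
  also have "(A - 1) + sqrt (A + 1) * sqrt (A - 1) \<le> sqrt (N + 1) * sqrt (A - 1) + sqrt (N + 1) * sqrt (A - 1)"
  proof (rule add_mono)
    have "A - 1 = sqrt (A - 1) * sqrt (A - 1)" using assms by simp
    also have "\<dots> \<le> sqrt (N + 1) * sqrt (A - 1)" using assms by (intro mult_right_mono) auto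
    finally show "A - 1 \<le> sqrt (N + 1) * sqrt (A - 1)" .
  qed (use assms in \<open>intro mult_right_mono, auto\<close>)
  finally show ?thesis by (simp add: mult.commute mult.left_commute)
qed

section \<open>The inverse Joukowski map and the Green function of an interval\<close>

text \<open>The solution w of w + 1/w = 2 z outside the unit disc. Written as z + csqrt (z^2 - 1) it
  would jump across the imaginary axis, where z^2 - 1 is negative; with \<open>z\<close> factored
  out, the cut of \<open>csqrt\<close> is not met off the interval from -1 to 1.\<close>

definition joukowski_inverse :: "complex \<Rightarrow> complex" where
  "joukowski_inverse z = z * (1 + csqrt (1 - 1 / z\<^sup>2))"

text \<open>If 1 - 1/z^2 = t \<le> 0, then z^2 = 1 / (1 - t) is positive and at most 1, so
  \<open>z\<close> is real and lies in the interval.\<close>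

lemma csqrt_arg_slit:
  fixes z :: complex
  assumes "z \<notin> complex_of_real ` {-1..1}"
  shows "1 - 1 / z\<^sup>2 \<notin> \<real>\<^sub>\<le>\<^sub>0"
proof
  assume "1 - 1 / z\<^sup>2 \<in> \<real>\<^sub>\<le>\<^sub>0"
  then obtain t where t: "t \<le> 0" "1 - 1 / z\<^sup>2 = complex_of_real t" by (auto elim: nonpos_Reals_cases)
  have "z \<noteq> 0" using assms by force
  have "1 / z\<^sup>2 = complex_of_real (1 - t)" using t(2) by (simp add: algebra_simps)
  then have "1 / (1 / z\<^sup>2) = complex_of_real (1 / (1 - t))" by (simp only: of_real_divide of_real_1)
  then have "z\<^sup>2 = complex_of_real (1 / (1 - t))" by simp
  then have z2: "z\<^sup>2 = complex_of_real ((sqrt (1 / (1 - t)))\<^sup>2)" using t(1) by simp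
  then have "z = complex_of_real (sqrt (1 / (1 - t))) \<or> z = - complex_of_real (sqrt (1 / (1 - t)))"
    by (simp only: of_real_power power2_eq_iff)
  then have "z = complex_of_real (sqrt (1 / (1 - t))) \<or> z = complex_of_real (- sqrt (1 / (1 - t)))"
    by (simp only: of_real_minus)
  moreover have "sqrt (1 / (1 - t)) \<le> 1" "0 \<le> sqrt (1 / (1 - t))" using t(1) by auto
  ultimately obtain y where "z = complex_of_real y" "y \<in> {-1..1}" by fastforce
  then show False using assms by blast
qed

text \<open>With q the square root, z (1 + q) and z (1 - q) have product z^2 (1 - q^2) = 1 and sum 2
  z, so they are inverse to each other. Off the cut Re q > 0, hence |1 + q| > |1 - q|, and the first
  factor is the one of modulus above 1.\<close>

lemma joukowski_inverse:
  assumes "z \<notin> complex_of_real ` {-1..1}"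
  shows "1 < cmod (joukowski_inverse z)"
    and "joukowski_inverse z + inverse (joukowski_inverse z) = 2 * z"
proof -
  define q where "q = csqrt (1 - 1 / z\<^sup>2)"
  have "z \<noteq> 0" using assms by force
  have slit: "1 - 1 / z\<^sup>2 \<notin> \<real>\<^sub>\<le>\<^sub>0" using csqrt_arg_slit[OF assms] .
  have q2: "q\<^sup>2 = 1 - 1 / z\<^sup>2" unfolding q_def by simp
  have "0 < Re q"
  proof -
    have "0 \<le> Re q" unfolding q_def by (rule Re_csqrt)
    moreover have "Re q \<noteq> 0"
    proof
      assume "Re q = 0"
      then have "q = \<i> * complex_of_real (Im q)" by (simp add: complex_eq_iff)
      then have "q\<^sup>2 = (\<i> * complex_of_real (Im q))\<^sup>2" by simp
      then have "q\<^sup>2 = complex_of_real (- (Im q)\<^sup>2)" by (simp add: power_mult_distrib)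
      then have "q\<^sup>2 \<in> \<real>\<^sub>\<le>\<^sub>0" by (simp del: of_real_minus of_real_power)
      then show False using slit q2 by simp
    qed
    ultimately show ?thesis by simp
  qed
  have \<phi>: "joukowski_inverse z = z * (1 + q)" unfolding joukowski_inverse_def q_def by simp
  have prod: "z * (1 + q) * (z * (1 - q)) = 1"
  proof -
    have "z * (1 + q) * (z * (1 - q)) = z\<^sup>2 * (1 - q\<^sup>2)" by (simp add: power2_eq_square algebra_simps)
    then show ?thesis using q2 \<open>z \<noteq> 0\<close> by simp
  qed
  then have inv: "inverse (joukowski_inverse z) = z * (1 - q)"
    unfolding \<phi> by (metis inverse_unique)
  show "joukowski_inverse z + inverse (joukowski_inverse z) = 2 * z"
    by (simp only: inv) (simp add: \<phi> algebra_simps)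
  have "(cmod (1 - q))\<^sup>2 < (cmod (1 + q))\<^sup>2"
    using \<open>0 < Re q\<close> unfolding cmod_power2 by (simp add: power2_eq_square algebra_simps)
  then have "cmod (1 - q) < cmod (1 + q)" by (rule power2_less_imp_less) simp
  then have lt: "cmod (z * (1 - q)) < cmod (z * (1 + q))" using \<open>z \<noteq> 0\<close> by (simp add: norm_mult)
  have "cmod (z * (1 + q)) * cmod (z * (1 - q)) = 1" using prod by (metis norm_mult norm_one)
  moreover have "cmod (z * (1 + q)) * cmod (z * (1 - q)) < 1" if "cmod (z * (1 + q)) \<le> 1"
    using lt that mult_left_le_one_le[of "cmod (z * (1 - q))" "cmod (z * (1 + q))"] by auto
  ultimately show "1 < cmod (joukowski_inverse z)"
    unfolding \<phi> by fastforce
qed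

text \<open>With \<phi> the Joukowski inverse, z - 1 and z + 1 are (\<phi> - 1)^2 and (\<phi> + 1)^2
  divided by 2 \<phi>. The parallelogram law turns the focal sum into |\<phi>| + 1/|\<phi>| = 2 cosh
  (ln |\<phi>|).\<close>

lemma ellipse_joukowski:
  assumes "z \<notin> complex_of_real ` {-1..1}"
  shows "arcosh ((cmod (z - 1) + cmod (z + 1)) / 2) = ln (cmod (joukowski_inverse z))"
proof -
  define \<phi> where "\<phi> = joukowski_inverse z"
  have \<phi>: "1 < cmod \<phi>" "\<phi> + inverse \<phi> = 2 * z" using joukowski_inverse[OF assms] unfolding \<phi>_def by auto
  have "\<phi> \<noteq> 0" using \<phi> by auto
  have "z - 1 = (\<phi> - 1)\<^sup>2 / (2 * \<phi>)" "z + 1 = (\<phi> + 1)\<^sup>2 / (2 * \<phi>)"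
  proof -
    have z: "z = (\<phi> + inverse \<phi>) / 2" using \<phi>(2) by simp
    show "z - 1 = (\<phi> - 1)\<^sup>2 / (2 * \<phi>)" "z + 1 = (\<phi> + 1)\<^sup>2 / (2 * \<phi>)"
      unfolding z using \<open>\<phi> \<noteq> 0\<close> by (auto simp: field_simps power2_eq_square)
  qed
  then have "cmod (z - 1) + cmod (z + 1) = ((cmod (\<phi> - 1))\<^sup>2 + (cmod (\<phi> + 1))\<^sup>2) / (2 * cmod \<phi>)"
    by (simp add: norm_divide norm_mult norm_power add_divide_distrib)
  also have "(cmod (\<phi> - 1))\<^sup>2 + (cmod (\<phi> + 1))\<^sup>2 = 2 * (cmod \<phi>)\<^sup>2 + 2"
    unfolding cmod_power2 by (simp add: power2_eq_square algebra_simps)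
  also have "(2 * (cmod \<phi>)\<^sup>2 + 2) / (2 * cmod \<phi>) = cmod \<phi> + inverse (cmod \<phi>)"
    using \<open>\<phi> \<noteq> 0\<close> by (simp add: field_simps power2_eq_square)
  finally have "(cmod (z - 1) + cmod (z + 1)) / 2 = cosh (ln (cmod \<phi>))"
    using \<open>\<phi> \<noteq> 0\<close> by (simp add: cosh_ln_real)
  then show ?thesis using \<phi>(1) unfolding \<phi>_def by (simp add: arcosh_cosh_real)
qed

lemma harmonic_on_ellipse:
  "harmonic_on (- complex_of_real ` {-1..1}) (\<lambda>z. arcosh ((cmod (z - 1) + cmod (z + 1)) / 2))"
proof -
  have cl: "open (- complex_of_real ` {-1..1})"
    by (intro open_Compl compact_imp_closed compact_continuous_image continuous_intros) auto
  have hol: "joukowski_inverse holomorphic_on (- complex_of_real ` {-1..1})"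
    unfolding joukowski_inverse_def
    using csqrt_arg_slit by (intro holomorphic_intros) force+
  have nz: "joukowski_inverse ` (- complex_of_real ` {-1..1}) \<subseteq> - {0}"
    using joukowski_inverse(1) by fastforce
  have h: "harmonic_on (- complex_of_real ` {-1..1}) (\<lambda>z. ln (cmod (joukowski_inverse z)))"
    by (rule harmonic_on_compose_holomorphic[OF harmonic_on_ln_cmod hol cl nz])
  show ?thesis
    by (rule harmonic_on_cong[OF h]) (simp add: ellipse_joukowski)
qed

text \<open>The Green function of \<open>[a, b]\<close> with pole at infinity; its level lines are the ellipses with
  foci \<open>a\<close> and \<open>b\<close>.\<close>

definition interval_green :: "real \<Rightarrow> real \<Rightarrow> complex \<Rightarrow> real" where
  "interval_green a b z =
     arcosh ((cmod (z - complex_of_real a) + cmod (z - complex_of_real b)) / (b - a))"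

lemma focal_sum_ge_1:
  fixes a b :: real
  assumes "a < b"
  shows "1 \<le> (cmod (z - complex_of_real a) + cmod (z - complex_of_real b)) / (b - a)"
proof -
  have "b - a = cmod ((z - complex_of_real a) - (z - complex_of_real b))"
  proof -
    have "(z - complex_of_real a) - (z - complex_of_real b) = complex_of_real (b - a)" by simp
    then show ?thesis using assms by (simp only: norm_of_real)
  qed
  also have "\<dots> \<le> cmod (z - complex_of_real a) + cmod (z - complex_of_real b)"
    by (rule norm_triangle_ineq4)
  finally show ?thesis using assms by simp
qed

lemma continuous_on_interval_green:
  assumes "a < b" shows "continuous_on S (interval_green a b)"
  unfolding interval_green_def
proof (rule continuous_on_compose2[OF continuous_on_arcosh[OF order_refl]])
  show "continuous_on S (\<lambda>z. (cmod (z - complex_of_real a) + cmod (z - complex_of_real b)) / (b - a))"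
    using assms by (intro continuous_intros) auto
qed (use focal_sum_ge_1[OF assms] in auto)

lemma interval_green_nonneg:
  assumes "a < b" shows "0 \<le> interval_green a b z"
  unfolding interval_green_def using focal_sum_ge_1[OF assms] by (intro arcosh_nonneg_real)

definition normalize_interval :: "real \<Rightarrow> real \<Rightarrow> complex \<Rightarrow> complex" where
  "normalize_interval a b z = (2 * z - complex_of_real (a + b)) / complex_of_real (b - a)"

lemma interval_green_normalize:
  assumes "a < b"
  shows "interval_green a b z =
    arcosh ((cmod (normalize_interval a b z - 1) + cmod (normalize_interval a b z + 1)) / 2)"
proof -
  have ne: "complex_of_real b - complex_of_real a \<noteq> 0" using assms by simp
  have "normalize_interval a b z - 1 = 2 * (z - complex_of_real b) / complex_of_real (b - a)"
       "normalize_interval a b z + 1 = 2 * (z - complex_of_real a) / complex_of_real (b - a)"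
    unfolding normalize_interval_def using ne by (auto simp: field_simps)
  moreover have "cmod (complex_of_real (b - a)) = b - a" using assms unfolding norm_of_real by simp
  ultimately have n: "cmod (normalize_interval a b z - 1) = 2 * cmod (z - complex_of_real b) / (b - a)"
       "cmod (normalize_interval a b z + 1) = 2 * cmod (z - complex_of_real a) / (b - a)"
    by (simp_all only: norm_divide norm_mult norm_numeral)
  have e: "(2 * p / c + 2 * q / c) / 2 = (q + p) / c" for p q c :: real
    by (simp add: add_divide_distrib)
  show ?thesis unfolding interval_green_def n e ..
qed

lemma normalize_interval_mem:
  assumes "a < b" "normalize_interval a b z \<in> complex_of_real ` {-1..1}"
  shows "z \<in> complex_of_real ` {a..b}"
proof -
  obtain t where t: "t \<in> {-1..1}" "normalize_interval a b z = complex_of_real t" using assms by auto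
  have "complex_of_real (b - a) \<noteq> 0" using assms(1) by (subst of_real_eq_0_iff) simp
  then have "2 * z = complex_of_real t * complex_of_real (b - a) + complex_of_real (a + b)"
    using t(2) unfolding normalize_interval_def by (simp add: field_simps)
  then have "z = complex_of_real ((t * (b - a) + (a + b)) / 2)" by (simp add: field_simps)
  moreover have "(t * (b - a) + (a + b)) / 2 \<in> {a..b}"
    using mult_right_mono[of t 1 "b - a"] mult_right_mono[of "-1" t "b - a"] t(1) assms(1)
    by (auto simp: field_simps)
  ultimately show ?thesis by blast
qed

lemma harmonic_on_interval_green:
  assumes "a < b"
  shows "harmonic_on (- complex_of_real ` {a..b}) (interval_green a b)"
proof -
  have "open (- complex_of_real ` {a..b})"
    by (intro open_Compl compact_imp_closed compact_continuous_image continuous_intros) auto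
  moreover have "normalize_interval a b holomorphic_on - complex_of_real ` {a..b}"
    unfolding normalize_interval_def using assms by (intro holomorphic_intros) auto
  moreover have "normalize_interval a b ` (- complex_of_real ` {a..b}) \<subseteq> - complex_of_real ` {-1..1}"
    by (intro image_subsetI ComplI) (use normalize_interval_mem[OF assms] in blast)
  ultimately have h: "harmonic_on (- complex_of_real ` {a..b})
      (\<lambda>z. arcosh ((cmod (normalize_interval a b z - 1) + cmod (normalize_interval a b z + 1)) / 2))"
    by (intro harmonic_on_compose_holomorphic[OF harmonic_on_ellipse])
  show ?thesis
    by (rule harmonic_on_cong[OF h]) (simp add: interval_green_normalize[OF assms])
qed

lemma interval_green_pos:
  assumes "a < b" "z \<notin> complex_of_real ` {a..b}"
  shows "0 < interval_green a b z"
proof -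
  have nm: "normalize_interval a b z \<notin> complex_of_real ` {-1..1}"
    using normalize_interval_mem assms by blast
  from joukowski_inverse(1)[OF nm] show ?thesis
    unfolding interval_green_normalize[OF assms(1)] ellipse_joukowski[OF nm] by (rule ln_gt_zero)
qed

lemma interval_green_zero:
  assumes "a < b" "x \<in> {a..b}"
  shows "interval_green a b (complex_of_real x) = 0"
proof -
  have "cmod (complex_of_real x - complex_of_real a) = x - a" "cmod (complex_of_real x - complex_of_real b) = b - x"
    using assms(2) by (simp_all only: of_real_diff[symmetric] norm_of_real, auto)
  then show ?thesis unfolding interval_green_def using assms by simp
qed

lemma interval_green_eq_0_iff:
  assumes "a < b"
  shows "interval_green a b z = 0 \<longleftrightarrow> z \<in> complex_of_real ` {a..b}"
  using interval_green_pos[OF assms, of z] interval_green_zero[OF assms] by force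

text \<open>The 6 is 2 times 3: arcosh A \<le> ln (2 A), and the focal sum is at most 2 |z| + |a| +
  |b| \<le> 3 |z|.\<close>

lemma interval_green_le_ln:
  assumes "a < b" "\<bar>a\<bar> + \<bar>b\<bar> \<le> cmod z" "0 < cmod z"
  shows "interval_green a b z \<le> ln (cmod z) + ln (6 / (b - a))"
proof -
  let ?A = "(cmod (z - complex_of_real a) + cmod (z - complex_of_real b)) / (b - a)"
  have "interval_green a b z \<le> ln (2 * ?A)"
    unfolding interval_green_def using arcosh_le_ln focal_sum_ge_1[OF assms(1)] by blast
  also have "\<dots> \<le> ln (cmod z * (6 / (b - a)))"
  proof (subst ln_le_cancel_iff)
    show "0 < 2 * ?A" using focal_sum_ge_1[OF assms(1), of z] by linarith
    have "cmod (z - complex_of_real a) + cmod (z - complex_of_real b) \<le> 3 * cmod z"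
      using norm_triangle_ineq4[of z "complex_of_real a"] norm_triangle_ineq4[of z "complex_of_real b"] assms(2)
      by simp
    then show "2 * ?A \<le> cmod z * (6 / (b - a))" using assms(1) by (simp add: divide_simps)
  qed (use assms in auto)
  also have "\<dots> = ln (cmod z) + ln (6 / (b - a))" using assms by (subst ln_mult) auto
  finally show ?thesis .
qed

text \<open>In the coordinate \<zeta> = 1/z the normalized point is Z = N / ((b - a) \<zeta>), and
  \<open>\<kappa>\<close> is 1/Z. The Joukowski inverse of Z is therefore \<Phi> / \<zeta> with
  \<Phi> holomorphic and nonzero near 0, and ln |\<Phi>| is the harmonic remainder.\<close>

lemma log_pole_interval_green:
  assumes "a < b" "\<And>z. u (Some z) = interval_green a b z"
  shows "log_pole None u"
proof -
  define N where "N \<zeta> = 2 - complex_of_real (a + b) * \<zeta>" for \<zeta>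
  define \<kappa> where "\<kappa> \<zeta> = complex_of_real (b - a) * \<zeta> / N \<zeta>" for \<zeta>
  define \<Phi> where "\<Phi> \<zeta> = N \<zeta> / complex_of_real (b - a) * (1 + csqrt (1 - (\<kappa> \<zeta>)\<^sup>2))" for \<zeta>
  have ne: "complex_of_real (b - a) \<noteq> 0" using assms(1) by (subst of_real_eq_0_iff) simp
  have U: "isCont N 0" unfolding N_def by (intro continuous_intros)
  have "isCont \<kappa> 0" unfolding \<kappa>_def using U by (intro continuous_intros) (auto simp: N_def)
  then have "\<exists>d>0. \<forall>\<zeta>. dist \<zeta> 0 < d \<longrightarrow> dist (\<kappa> \<zeta>) (\<kappa> 0) < 1"
    unfolding continuous_at_eps_delta using zero_less_one by blast
  then obtain r1 where r1: "0 < r1" "\<And>\<zeta>. cmod \<zeta> < r1 \<Longrightarrow> cmod (\<kappa> \<zeta>) < 1"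
    unfolding \<kappa>_def dist_norm by (metis diff_zero div_0 mult_zero_right)
  have "\<exists>d>0. \<forall>\<zeta>. dist \<zeta> 0 < d \<longrightarrow> dist (N \<zeta>) (N 0) < 1"
    using U unfolding continuous_at_eps_delta using zero_less_one by blast
  then obtain r2 where r2: "0 < r2" "\<And>\<zeta>. cmod \<zeta> < r2 \<Longrightarrow> cmod (N \<zeta> - 2) < 1"
    unfolding N_def dist_norm by (metis diff_zero mult_zero_right)
  \<comment> \<open>\<open>r1\<close> gives |1/Z| < 1, which keeps the argument of
    \<open>csqrt\<close> off its cut and Z off the slit; \<open>r2\<close> keeps \<open>N\<close>
    away from 0.\<close>
  define r where "r = min r1 r2"
  have r: "0 < r" using r1 r2 unfolding r_def by simp
  have Nne: "N \<zeta> \<noteq> 0" if "\<zeta> \<in> ball 0 r" for \<zeta>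
    using r2(2)[of \<zeta>] that unfolding r_def by auto
  have slit: "1 - (\<kappa> \<zeta>)\<^sup>2 \<notin> \<real>\<^sub>\<le>\<^sub>0" if "\<zeta> \<in> ball 0 r" for \<zeta>
  proof
    assume "1 - (\<kappa> \<zeta>)\<^sup>2 \<in> \<real>\<^sub>\<le>\<^sub>0"
    then have "Re (1 - (\<kappa> \<zeta>)\<^sup>2) \<le> 0" by (simp add: complex_nonpos_Reals_iff)
    then have "1 \<le> Re ((\<kappa> \<zeta>)\<^sup>2)" by simp
    also have "\<dots> \<le> cmod ((\<kappa> \<zeta>)\<^sup>2)" by (rule complex_Re_le_cmod)
    also have "\<dots> < 1" using r1(2)[of \<zeta>] that unfolding r_def by (simp add: norm_power power_less_one_iff)
    finally show False by simp
  qed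
  have hol: "\<Phi> holomorphic_on ball 0 r"
    unfolding \<Phi>_def \<kappa>_def using Nne slit ne
    by (intro holomorphic_intros) (auto simp: N_def \<kappa>_def intro!: holomorphic_intros)
  have \<Phi>ne: "\<Phi> \<zeta> \<noteq> 0" if "\<zeta> \<in> ball 0 r" for \<zeta>
  proof -
    have "0 \<le> Re (csqrt (1 - (\<kappa> \<zeta>)\<^sup>2))" by (rule Re_csqrt)
    then have "0 < Re (1 + csqrt (1 - (\<kappa> \<zeta>)\<^sup>2))" unfolding plus_complex.sel one_complex.sel by linarith
    then have "1 + csqrt (1 - (\<kappa> \<zeta>)\<^sup>2) \<noteq> 0" by force
    then show ?thesis unfolding \<Phi>_def using Nne[OF that] ne by simp
  qed
  have harm: "harmonic_on (ball 0 r) (\<lambda>\<zeta>. ln (cmod (\<Phi> \<zeta>)))"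
    by (rule harmonic_on_compose_holomorphic[OF harmonic_on_ln_cmod hol]) (use \<Phi>ne in auto)
  have "u (chart None \<zeta>) = ln (cmod (\<Phi> \<zeta>)) - ln (cmod \<zeta>)" if \<zeta>: "\<zeta> \<in> ball 0 r - {0}" for \<zeta>
  proof -
    have "\<zeta> \<noteq> 0" "\<zeta> \<in> ball 0 r" using \<zeta> by auto
    define Z where "Z = normalize_interval a b (inverse \<zeta>)"
    have Z: "Z = N \<zeta> / (complex_of_real (b - a) * \<zeta>)"
      unfolding Z_def normalize_interval_def N_def using \<open>\<zeta> \<noteq> 0\<close> ne by (simp add: field_simps)
    have inv: "1 / Z\<^sup>2 = (\<kappa> \<zeta>)\<^sup>2"
      unfolding Z \<kappa>_def by (simp add: power_divide)
    have "Z \<noteq> 0" unfolding Z using Nne \<open>\<zeta> \<noteq> 0\<close> \<open>\<zeta> \<in> ball 0 r\<close> ne by simp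
    have "cmod (inverse Z) < 1"
      using r1(2)[of \<zeta>] \<open>\<zeta> \<in> ball 0 r\<close> unfolding Z \<kappa>_def r_def by simp
    then have "1 < cmod Z" using \<open>Z \<noteq> 0\<close> by (simp add: norm_inverse inverse_less_1_iff) 
    then have "Z \<notin> complex_of_real ` {-1..1}" by auto
    then have "arcosh ((cmod (Z - 1) + cmod (Z + 1)) / 2) = ln (cmod (joukowski_inverse Z))"
      by (rule ellipse_joukowski)
    moreover have "u (chart None \<zeta>) = interval_green a b (inverse \<zeta>)"
      using \<open>\<zeta> \<noteq> 0\<close> assms(2) by simp
    ultimately have "u (chart None \<zeta>) = ln (cmod (joukowski_inverse Z))"
      unfolding interval_green_normalize[OF assms(1)] Z_def[symmetric] by simp
    also have "joukowski_inverse Z = Z * (1 + csqrt (1 - (\<kappa> \<zeta>)\<^sup>2))"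
      unfolding joukowski_inverse_def inv by (rule refl)
    also have "\<dots> = \<Phi> \<zeta> / \<zeta>"
      unfolding \<Phi>_def Z by simp
    also have "ln (cmod (\<Phi> \<zeta> / \<zeta>)) = ln (cmod (\<Phi> \<zeta>)) - ln (cmod \<zeta>)"
      using \<open>\<zeta> \<noteq> 0\<close> \<Phi>ne[OF \<open>\<zeta> \<in> ball 0 r\<close>] by (simp add: norm_divide ln_div)
    finally show ?thesis .
  qed
  then show ?thesis unfolding log_pole_def using r harm by blast
qed

text \<open>The Green function of a part of \<open>E\<close> remains harmonic and positive off the
  larger set \<open>E\<close>, so it competes in the infimum. Its value at \<open>None\<close> is an
  arbitrary default: every condition on a candidate leaves out the pole itself.\<close>

lemma interval_green_candidate:
  assumes "a < b" "{a..b} \<subseteq> E" "compact E"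
  shows "(\<lambda>p. case p of None \<Rightarrow> 0 | Some z \<Rightarrow> interval_green a b z) \<in> green_candidates E None"
proof -
  let ?u = "\<lambda>p. case p of None \<Rightarrow> 0 | Some z \<Rightarrow> interval_green a b z"
  have "open (- complex_of_real ` E)"
    using assms(3) by (intro open_Compl compact_imp_closed compact_continuous_image continuous_intros) auto
  have mem: "Some z \<in> Omega E - {None} \<longleftrightarrow> z \<notin> complex_of_real ` E" for z
    unfolding Omega_def real_pts_def by auto
  have "\<exists>r>0. chart p ` ball 0 r \<subseteq> Omega E - {None} \<and> harmonic_on (ball 0 r) (?u \<circ> chart p)"
    if p: "p \<in> Omega E - {None}" for p
  proof -
    obtain z where z: "p = Some z" using p by (cases p) auto
    then have "z \<in> - complex_of_real ` E" using p mem by auto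
    then obtain r where r: "0 < r" "ball z r \<subseteq> - complex_of_real ` E"
      using \<open>open (- complex_of_real ` E)\<close> open_contains_ball by blast
    have sub: "z + \<zeta> \<notin> complex_of_real ` E" if "\<zeta> \<in> ball 0 r" for \<zeta>
      using r(2) that by (auto simp: subset_iff dist_norm)
    have "z + \<zeta> \<in> - complex_of_real ` {a..b}" if "\<zeta> \<in> ball 0 r" for \<zeta>
      using sub[OF that] assms(2) by auto
    then have "(\<lambda>\<zeta>. z + \<zeta>) ` ball 0 r \<subseteq> - complex_of_real ` {a..b}"
      by (rule image_subsetI)
    then have "harmonic_on (ball 0 r) (\<lambda>\<zeta>. interval_green a b (z + \<zeta>))"
      by (intro harmonic_on_compose_holomorphic[OF harmonic_on_interval_green[OF assms(1)]])
        (auto intro!: holomorphic_intros)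
    moreover have "?u \<circ> chart p = (\<lambda>\<zeta>. interval_green a b (z + \<zeta>))" unfolding z by (auto simp: fun_eq_iff)
    moreover have "chart p ` ball 0 r \<subseteq> Omega E - {None}" unfolding z using sub mem by auto
    ultimately show ?thesis using r(1) by auto
  qed
  moreover have "0 < ?u p" if p: "p \<in> Omega E - {None}" for p
  proof -
    obtain z where z: "p = Some z" using p by (cases p) auto
    then have "z \<notin> complex_of_real ` {a..b}" using p mem assms(2) by auto
    then show ?thesis unfolding z using interval_green_pos[OF assms(1)] by simp
  qed
  moreover have "log_pole None ?u" by (rule log_pole_interval_green[OF assms(1)]) simp
  ultimately show ?thesis unfolding green_candidates_def sphere_harmonic_on_def by blast
qed


section \<open>Two-sided bounds with pole at infinity\<close>

lemma green_candidate_harmonic_at: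
  assumes "u \<in> green_candidates E w" "z \<notin> complex_of_real ` E" "Some z \<noteq> w"
  shows "\<exists>r>0. harmonic_on (ball z r) (\<lambda>z. u (Some z))"
proof -
  have "Some z \<in> Omega E - {w}" using assms(2,3) unfolding Omega_def real_pts_def by auto
  then obtain r where r: "0 < r" "harmonic_on (ball 0 r) (u \<circ> chart (Some z))"
    using assms(1) unfolding green_candidates_def sphere_harmonic_on_def by blast
  have "(\<lambda>y. y - z) ` ball z r \<subseteq> ball 0 r"
    by (auto simp: dist_norm norm_minus_commute)
  then have "harmonic_on (ball z r) (\<lambda>y. (u \<circ> chart (Some z)) (y - z))"
    by (intro harmonic_on_compose_holomorphic[OF r(2)]) (auto intro!: holomorphic_intros)
  then show ?thesis using r(1) by auto
qed

text \<open>The harmonic remainder is bounded on the closed disc of radius r/2, and |z| \<ge> 2/r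
  puts 1/z there.\<close>

lemma green_candidate_lower_at_infinity:
  assumes "u \<in> green_candidates E None"
  shows "\<exists>R B. \<forall>z. R \<le> cmod z \<longrightarrow> ln (cmod z) - B \<le> u (Some z)"
proof -
  obtain r h where r: "0 < r" "harmonic_on (ball 0 r) h"
    and h: "\<And>\<zeta>. \<zeta> \<in> ball 0 r - {0} \<Longrightarrow> u (chart None \<zeta>) = h \<zeta> - ln (cmod \<zeta>)"
    using assms unfolding green_candidates_def log_pole_def by blast
  have "continuous_on (cball 0 (r / 2)) h"
    using r(1) by (intro continuous_on_subset[OF harmonic_on_imp_continuous_on[OF r(2)]]) auto
  then have "compact (h ` cball 0 (r / 2))" by (intro compact_continuous_image) auto
  then obtain B where B: "\<And>\<zeta>. \<zeta> \<in> cball 0 (r / 2) \<Longrightarrow> norm (h \<zeta>) \<le> B"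
    using compact_imp_bounded bounded_iff by (metis imageI)
  have "ln (cmod z) - B \<le> u (Some z)" if z: "2 / r \<le> cmod z" for z
  proof -
    have "0 < cmod z" using z r(1) by (smt (verit) divide_pos_pos)
    then have "inverse (cmod z) \<le> r / 2" using z r(1) by (simp add: field_simps)
    then have b: "inverse z \<in> cball 0 (r / 2)" by (simp add: norm_inverse)
    then have "inverse z \<in> ball 0 r - {0}" using r(1) \<open>0 < cmod z\<close> by auto
    from h[OF this] have "u (Some z) = h (inverse z) + ln (cmod z)"
      using \<open>0 < cmod z\<close> by (simp add: norm_inverse ln_inverse)
    then show ?thesis using B[OF b] by simp
  qed
  then show ?thesis by blast
qed

text \<open>The comparison is applied to each candidate separately, since the constants
  \<open>R0\<close> and \<open>B0\<close> of its behaviour at infinity depend on the candidate. The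
  resulting inequality does not, so it passes to the infimum.\<close>

lemma le_green:
  fixes E K C :: "real set"
  assumes "compact E" and E: "E = K \<union> C" and "countable C"
    and s_cont: "continuous_on UNIV s" and s_nonneg: "\<And>z. 0 \<le> s z"
    and s_K: "\<And>x. x \<in> K \<Longrightarrow> s (complex_of_real x) = 0" and s_bdd: "bounded {z. s z = 0}"
    and s_harm: "harmonic_on {z. 0 < s z} s"
    and s_inf: "\<And>z. R1 \<le> cmod z \<Longrightarrow> s z \<le> ln (cmod z) + B1"
    and z: "z \<notin> complex_of_real ` E"
  shows "ennreal (s z) \<le> green E None (Some z)"
proof -
  have "s z \<le> u (Some z)" if u: "u \<in> green_candidates E None" for u
  proof -
    obtain R0 B0 where RB: "\<And>z. R0 \<le> cmod z \<Longrightarrow> ln (cmod z) - B0 \<le> u (Some z)"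
      using green_candidate_lower_at_infinity[OF u] by blast
    show ?thesis
    proof (rule comparison_exceptional_set[of "complex_of_real ` E" "complex_of_real ` K" "complex_of_real ` C"])
      show "compact (complex_of_real ` E)"
        using \<open>compact E\<close> by (intro compact_continuous_image continuous_intros)
      show "\<exists>r>0. harmonic_on (ball z r) (\<lambda>z. u (Some z))" if "z \<notin> complex_of_real ` E" for z
        using green_candidate_harmonic_at[OF u that] by simp
      show "0 < u (Some z)" if "z \<notin> complex_of_real ` E" for z
        using u that unfolding green_candidates_def Omega_def real_pts_def by auto
    qed (use assms RB in auto)
  qed
  then show ?thesis unfolding green_def by (auto intro!: INF_greatest ennreal_leI)
qed

text \<open>With \<open>m\<close> the midpoint of the gap \<open>(p, q)\<close>, half the Green function of \<open>[r\<^sub>1\<^sup>2, r\<^sub>2\<^sup>2]\<close> at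
  \<open>(z - m)\<^sup>2\<close> is the Green function of the two intervals \<open>r\<^sub>1 \<le> \<bar>x - m\<bar> \<le> r\<^sub>2\<close>, which contain \<open>K\<close>.\<close>

lemma green_lower_bound_in_gap:
  fixes E K C :: "real set"
  assumes "compact E" and E: "E = K \<union> C" and "countable C"
    and gap: "K \<inter> {p<..<q} = {}" and N: "0 < N" "K \<subseteq> {-N..N}" "-N \<le> p" "p < q" "q \<le> N"
  shows "\<exists>s. continuous_on UNIV s \<and>
    (\<forall>z. z \<notin> complex_of_real ` E \<longrightarrow> ennreal (s z) \<le> green E None (Some z)) \<and>
    (\<forall>x\<in>{p<..<q}. sqrt ((x - p) * (q - x)) / (12 * N) \<le> s (complex_of_real x))"
proof -
  define m where "m = (p + q) / 2"
  define a where "a = ((q - p) / 2)\<^sup>2"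
  \<comment> \<open>On \<open>K\<close> one has |x - m| \<le> 2 N, which 3 N covers, and a \<le> N^2
    leaves \<open>b - a\<close> at least 8 N^2.\<close>
  define b where "b = (3 * N)\<^sup>2"
  have half: "(q - p) / 2 \<le> N" "0 < (q - p) / 2" using N by auto
  have aN: "0 < a" "a \<le> N\<^sup>2" unfolding a_def using half by (auto intro: power_mono)
  have N2: "0 < N\<^sup>2" using N(1) by simp
  have b9: "b = 9 * N\<^sup>2" unfolding b_def by (simp add: power_mult_distrib)
  have ab: "a < b" using aN N2 b9 by linarith
  have mN: "\<bar>m\<bar> \<le> N" unfolding m_def using N by auto
  define G where "G = interval_green a b"
  \<comment> \<open>Squaring doubles the growth at infinity; the factor 1/2 restores ln |z|.\<close>
  define s where "s z = 1 / 2 * G ((z - complex_of_real m)\<^sup>2)" for z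
  have G_cont: "continuous_on S G" for S unfolding G_def by (rule continuous_on_interval_green[OF ab])
  have s_cont: "continuous_on UNIV s"
    unfolding s_def by (intro continuous_intros continuous_on_compose2[OF G_cont[of UNIV]]) auto
  have s_nonneg: "0 \<le> s z" for z
    unfolding s_def G_def using interval_green_nonneg[OF ab] by simp
  have s_0: "s z = 0 \<longleftrightarrow> (z - complex_of_real m)\<^sup>2 \<in> complex_of_real ` {a..b}" for z
    unfolding s_def G_def using interval_green_eq_0_iff[OF ab] by simp
  have "s (complex_of_real x) = 0" if x: "x \<in> K" for x
  proof -
    have "(x - m)\<^sup>2 \<in> {a..b}"
    proof -
      have "(q - p) / 2 \<le> \<bar>x - m\<bar>" using x gap unfolding m_def by (auto simp: abs_if field_simps)
      moreover have "x \<in> {-N..N}" using x N(2) by blast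
      then have "\<bar>x - m\<bar> \<le> 3 * N" using mN N(1) by (auto simp: abs_le_iff)
      ultimately have "((q - p) / 2)\<^sup>2 \<le> \<bar>x - m\<bar>\<^sup>2" "\<bar>x - m\<bar>\<^sup>2 \<le> (3 * N)\<^sup>2"
        using half by (intro power_mono; linarith)+
      then show ?thesis unfolding a_def b_def power2_abs by simp
    qed
    then show ?thesis unfolding s_0 by (metis image_eqI of_real_diff of_real_power)
  qed
  moreover have "bounded {z. s z = 0}"
  proof (rule bounded_subset[OF bounded_cball])
    show "{z. s z = 0} \<subseteq> cball (complex_of_real m) (3 * N)"
    proof
      fix z assume "z \<in> {z. s z = 0}"
      then obtain t where t: "t \<in> {a..b}" "(z - complex_of_real m)\<^sup>2 = complex_of_real t"
        using s_0 by auto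
      then have "(cmod (z - complex_of_real m))\<^sup>2 = \<bar>t\<bar>" by (metis norm_of_real norm_power)
      also have "\<dots> \<le> b" using t(1) aN(1) by simp
      also have "b = (3 * N)\<^sup>2" by (rule b_def)
      finally have "cmod (z - complex_of_real m) \<le> 3 * N"
        by (rule power2_le_imp_le) (use N(1) in simp)
      then show "z \<in> cball (complex_of_real m) (3 * N)" by (simp add: dist_norm norm_minus_commute)
    qed
  qed
  moreover have "harmonic_on {z. 0 < s z} s"
  proof -
    have "open {z. 0 < s z}" using s_cont by (intro open_Collect_less) auto
    moreover have "(z - complex_of_real m)\<^sup>2 \<in> - complex_of_real ` {a..b}" if "0 < s z" for z
      using that s_0[of z] by auto
    then have "(\<lambda>z. (z - complex_of_real m)\<^sup>2) ` {z. 0 < s z} \<subseteq> - complex_of_real ` {a..b}"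
      by (intro image_subsetI) auto
    ultimately have "harmonic_on {z. 0 < s z} (\<lambda>z. G ((z - complex_of_real m)\<^sup>2))"
      unfolding G_def
      by (intro harmonic_on_compose_holomorphic[OF harmonic_on_interval_green[OF ab]])
        (auto intro!: holomorphic_intros)
    then show ?thesis unfolding s_def by (rule harmonic_on_cmult)
  qed
  moreover have "s z \<le> ln (cmod z) + (ln 2 + ln (6 / (b - a)) / 2)" if z: "5 * N \<le> cmod z" for z
  proof -
    define w where "w = cmod (z - complex_of_real m)"
    have w: "4 * N \<le> w" "w \<le> 2 * cmod z"
      using norm_triangle_ineq2[of z "complex_of_real m"] norm_triangle_ineq4[of z "complex_of_real m"] mN z
      unfolding w_def by auto
    have w0: "0 < w" using w(1) N(1) by linarith
    have cw: "cmod ((z - complex_of_real m)\<^sup>2) = w\<^sup>2" unfolding w_def by (simp add: norm_power)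
    have "(4 * N)\<^sup>2 \<le> w\<^sup>2" using w(1) N(1) by (intro power_mono) auto
    then have "\<bar>a\<bar> + \<bar>b\<bar> \<le> w\<^sup>2" using aN b9 N2 by (simp add: power_mult_distrib)
    then have "G ((z - complex_of_real m)\<^sup>2) \<le> ln (w\<^sup>2) + ln (6 / (b - a))"
      using interval_green_le_ln[OF ab, of "(z - complex_of_real m)\<^sup>2"] w0 unfolding cw G_def by simp
    also have "ln (w\<^sup>2) = 2 * ln w" using w0 by (simp add: ln_realpow)
    finally have "s z \<le> ln w + ln (6 / (b - a)) / 2" unfolding s_def by simp
    also have "ln w \<le> ln (2 * cmod z)" using w w0 by (subst ln_le_cancel_iff) auto
    also have "ln (2 * cmod z) = ln 2 + ln (cmod z)" using w w0 by (subst ln_mult) auto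
    finally show ?thesis by simp
  qed
  ultimately have "ennreal (s z) \<le> green E None (Some z)" if "z \<notin> complex_of_real ` E" for z
    using le_green[OF assms(1-3) s_cont s_nonneg] that by blast
  moreover have "sqrt ((x - p) * (q - x)) / (12 * N) \<le> s (complex_of_real x)" if x: "x \<in> {p<..<q}" for x
  proof -
    \<comment> \<open>Inside the gap (x - m)^2 < a, so A - 1 is 2 (x - p) (q - x) / (b - a). The 12
      N of the claim is 3 N from sqrt b, times 2 from \<open>arcosh_ge_sqrt\<close>, times 2 from
      the factor 1/2 in \<open>s\<close>.\<close>
    define A where "A = (\<bar>(x - m)\<^sup>2 - a\<bar> + \<bar>(x - m)\<^sup>2 - b\<bar>) / (b - a)"
    have "(complex_of_real x - complex_of_real m)\<^sup>2 - complex_of_real t = complex_of_real ((x - m)\<^sup>2 - t)" for t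
      by simp
    then have sA: "s (complex_of_real x) = 1 / 2 * arcosh A"
      unfolding s_def G_def interval_green_def A_def by (simp only: norm_of_real)
    have prod: "a - (x - m)\<^sup>2 = (x - p) * (q - x)"
      unfolding a_def m_def by (simp add: power2_eq_square field_simps)
    have pos: "0 < (x - p) * (q - x)" using x by simp
    have "A = 1 + 2 * ((x - p) * (q - x)) / (b - a)"
      unfolding A_def using prod pos ab by (simp add: field_simps)
    then have A1: "A - 1 = 2 * ((x - p) * (q - x)) / (b - a)" by simp
    have "(x - p) * (q - x) \<le> N\<^sup>2" using prod aN zero_le_power2[of "x - m"] by linarith
    then have "2 * ((x - p) * (q - x)) / (b - a) \<le> 1" using aN b9 N2 ab by (simp add: divide_simps)
    moreover have "0 \<le> 2 * ((x - p) * (q - x)) / (b - a)" using pos ab by (intro divide_nonneg_pos) auto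
    ultimately have A2: "1 \<le> A" "A \<le> 2" using A1 by linarith+
    have "(x - p) * (q - x) / b \<le> 2 * ((x - p) * (q - x)) / (b - a)"
      by (rule frac_le) (use pos ab aN(1) in linarith)+
    then have "sqrt ((x - p) * (q - x) / (3 * N)\<^sup>2) \<le> sqrt (A - 1)"
      unfolding A1 b_def[symmetric] by (rule real_sqrt_le_mono)
    then have "sqrt ((x - p) * (q - x)) / (3 * N) \<le> sqrt (A - 1)"
      using N(1) unfolding real_sqrt_divide real_sqrt_abs by simp
    then show ?thesis using arcosh_ge_sqrt[OF A2] unfolding sA by simp
  qed
  ultimately show ?thesis using s_cont by blast
qed

lemma green_upper_bound_by_interval:
  assumes "a < b" "{a..b} \<subseteq> E" "compact E" "z \<notin> complex_of_real ` E"
  shows "green E None (Some z) \<le> ennreal (interval_green a b z)"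
  unfolding green_def using interval_green_candidate[OF assms(1-3)]
  by (auto intro: INF_lower2)

text \<open>The bounds are carried by continuous functions on the whole plane because
  \<open>x\<close> lies in \<open>E\<close>, where the Green function has only an upper limit from
  outside; values of continuous bounds pass to that limit. Finiteness of \<open>I\<close> makes
  \<open>c\<close> and \<open>D\<close> independent of \<open>x\<close>.\<close>

lemma green_bounds_pole_infinity:
  fixes I :: "(real \<times> real) set" and E C :: "real set"
  defines "K \<equiv> \<Union>(a, b)\<in>I. {a..b}"
  assumes I: "finite I" "I \<noteq> {}" "\<And>a b. (a, b) \<in> I \<Longrightarrow> a < b"
    and "compact E" and E: "E = K \<union> C" and "countable C"
  shows "\<exists>c>0. \<exists>D\<ge>0.
    (\<forall>x\<in>E - K. \<exists>s. continuous_on UNIV s \<and>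
       (\<forall>z. z \<notin> complex_of_real ` E \<longrightarrow> ennreal (s z) \<le> green E None (Some z)) \<and>
       c * sqrt (infdist x K) \<le> s (complex_of_real x)) \<and>
    (\<forall>x\<in>E. \<exists>g. continuous_on UNIV g \<and>
       (\<forall>z. z \<notin> complex_of_real ` E \<longrightarrow> green E None (Some z) \<le> ennreal (g z)) \<and>
       g (complex_of_real x) \<le> D * sqrt (infdist x K))"
proof -
  obtain N0 where N0: "\<And>x. x \<in> E \<Longrightarrow> norm x \<le> N0"
    using compact_imp_bounded[OF \<open>compact E\<close>] bounded_iff by metis
  define N where "N = max N0 0 + 1"
  have N: "1 \<le> N" "\<And>x. x \<in> E \<Longrightarrow> \<bar>x\<bar> \<le> N - 1" using N0 unfolding N_def by force+
  have "compact K"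
    unfolding K_def using I(1) by (intro compact_UN) auto
  have IK: "{a..b} \<subseteq> K" if "(a, b) \<in> I" for a b using that unfolding K_def by auto
  have "K \<noteq> {}" using I(2,3) IK by fastforce
  have near: "\<exists>k\<in>K. infdist x K = \<bar>x - k\<bar>" for x
    using infdist_attains_inf[OF compact_imp_closed[OF \<open>compact K\<close>] \<open>K \<noteq> {}\<close>] by (metis dist_real_def)
  have d_le: "infdist x K \<le> 2 * N" if "x \<in> E" for x
    using near[of x] N(2)[of x] N(2) that E by fastforce
  \<comment> \<open>The points N and -N, at distance at least 1 from \<open>E\<close>, close the two
    unbounded gaps, so that every point of \<open>E - K\<close> lies between two points of
    \<open>P\<close>.\<close>
  define P where "P = fst ` I \<union> snd ` I \<union> {- N, N}"
  have P: "finite P" unfolding P_def using I(1) by auto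
  have PK: "y \<in> K" if "y \<in> fst ` I \<union> snd ` I" for y
    using that IK I(3) by force
  have PN: "- N \<le> y" "y \<le> N" if y: "y \<in> P" for y
  proof -
    have "y \<in> E \<or> y = - N \<or> y = N" using y PK E unfolding P_def by blast
    then have "\<bar>y\<bar> \<le> N" using N(1) N(2)[of y] by auto
    then show "- N \<le> y" "y \<le> N" by linarith+
  qed
  define D0 where "D0 = insert 1 ((\<lambda>(p, q). q - p) ` {(p, q) \<in> P \<times> P. p < q})"
  have "finite {(p, q) \<in> P \<times> P. p < q}" using P by (intro finite_subset[OF _ finite_cartesian_product[OF P P]]) auto
  then have D0: "finite D0" "D0 \<noteq> {}" unfolding D0_def by auto
  define \<delta> where "\<delta> = Min D0"
  have \<delta>: "0 < \<delta>" "\<And>p q. p \<in> P \<Longrightarrow> q \<in> P \<Longrightarrow> p < q \<Longrightarrow> \<delta> \<le> q - p"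
  proof -
    show "0 < \<delta>" unfolding \<delta>_def using D0 by (subst Min_gr_iff) (auto simp: D0_def)
    show "\<delta> \<le> q - p" if "p \<in> P" "q \<in> P" "p < q" for p q
      unfolding \<delta>_def using D0(1) that by (intro Min_le) (force simp: D0_def)+
  qed
  \<comment> \<open>Comes from (x - p) (q - x) \<ge> (\<delta> / 2) (d / (2 N)), with d the distance
    to \<open>K\<close>, and from the 12 N of the gap estimate.\<close>
  define c where "c = sqrt (\<delta> / (4 * N)) / (12 * N)"
  have c: "0 < c" unfolding c_def using \<delta>(1) N(1) by simp
  have lower: "\<exists>s. continuous_on UNIV s \<and>
       (\<forall>z. z \<notin> complex_of_real ` E \<longrightarrow> ennreal (s z) \<le> green E None (Some z)) \<and>
       c * sqrt (infdist x K) \<le> s (complex_of_real x)" if x: "x \<in> E - K" for x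
  proof -
    have xN: "\<bar>x\<bar> \<le> N - 1" using N(2) x by blast
    define p where "p = Max {y \<in> P. y < x}"
    define q where "q = Min {y \<in> P. x < y}"
    have ne: "{y \<in> P. y < x} \<noteq> {}" "{y \<in> P. x < y} \<noteq> {}"
    proof -
      have "- N \<in> {y \<in> P. y < x}" "N \<in> {y \<in> P. x < y}" using xN unfolding P_def by auto
      then show "{y \<in> P. y < x} \<noteq> {}" "{y \<in> P. x < y} \<noteq> {}" by blast+
    qed
    have p: "p \<in> P" "p < x" "\<And>y. y \<in> P \<Longrightarrow> y < x \<Longrightarrow> y \<le> p"
      using Max_in[of "{y \<in> P. y < x}"] ne P unfolding p_def by auto
    have q: "q \<in> P" "x < q" "\<And>y. y \<in> P \<Longrightarrow> x < y \<Longrightarrow> q \<le> y"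
      using Min_in[of "{y \<in> P. x < y}"] ne P unfolding q_def by auto
    \<comment> \<open>An interval of \<open>I\<close> meeting the gap has no endpoint strictly
      between the neighbours \<open>p\<close> and \<open>q\<close> of \<open>x\<close> in
      \<open>P\<close>, so it would contain \<open>x\<close>.\<close>
    have gap: "K \<inter> {p<..<q} = {}"
    proof (rule ccontr)
      assume "K \<inter> {p<..<q} \<noteq> {}"
      then obtain k where k0: "k \<in> {p<..<q}" "k \<in> K" by blast
      then obtain a b where "(a, b) \<in> I" "k \<in> {a..b}" unfolding K_def by blast
      with k0 have k: "k \<in> {p<..<q}" "(a, b) \<in> I" "k \<in> {a..b}" by auto
      then have "a \<in> P" "b \<in> P" unfolding P_def by force+
      moreover have "x \<notin> {a..b}" using x IK[OF k(2)] by blast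
      ultimately show False using p(3)[of b] q(3)[of a] k by fastforce
    qed
    define d where "d = infdist x K"
    have d: "0 \<le> d" "d \<le> 2 * N" unfolding d_def using d_le x infdist_nonneg by auto
    \<comment> \<open>Dividing \<open>d\<close> by 2 N gives one bound for both kinds of endpoint:
      those in \<open>K\<close> are at distance at least \<open>d\<close> from \<open>x\<close>,
      while N and -N are at distance at least 1.\<close>
    have dN: "d / (2 * N) \<le> 1" "d / (2 * N) \<le> d"
      using d N(1) by (auto simp: divide_simps mult_le_cancel_left1)
    have dk: "d \<le> \<bar>x - k\<bar>" if "k \<in> K" for k
      unfolding d_def using infdist_le[OF that, of x] by (simp add: dist_real_def)
    have left: "d / (2 * N) \<le> x - p"
    proof (cases "p \<in> K")
      case True
      then show ?thesis using dk[of p] dN p(2) by linarith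
    next
      case False
      then have "p = - N \<or> p = N" using p(1) PK unfolding P_def by blast
      then have "p = - N" using xN p(2) by auto
      then show ?thesis using dN(1) xN by linarith
    qed
    have right: "d / (2 * N) \<le> q - x"
    proof (cases "q \<in> K")
      case True
      then show ?thesis using dk[of q] dN q(2) by linarith
    next
      case False
      then have "q = - N \<or> q = N" using q(1) PK unfolding P_def by blast
      then have "q = N" using xN q(2) by auto
      then show ?thesis using dN(1) xN by linarith
    qed
    \<comment> \<open>The two factors add up to q - p \<ge> \<delta>, so one of them is at least
      \<delta> / 2.\<close>
    have prod: "\<delta> / 2 * (d / (2 * N)) \<le> (x - p) * (q - x)"
    proof (cases "\<delta> / 2 \<le> x - p")
      case True
      then show ?thesis using right d N(1) p(2) by (intro mult_mono) auto
    next
      case False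
      then have "\<delta> / 2 \<le> q - x" using \<delta>(2)[OF p(1) q(1)] p(2) q(2) by linarith
      then have "\<delta> / 2 * (d / (2 * N)) \<le> (q - x) * (x - p)"
        using left d N(1) q(2) by (intro mult_mono) auto
      then show ?thesis by (simp add: mult.commute)
    qed
    have "c * sqrt d = sqrt (\<delta> / (4 * N) * d) / (12 * N)"
      unfolding c_def real_sqrt_mult by simp
    also have "\<dots> \<le> sqrt ((x - p) * (q - x)) / (12 * N)"
      using prod N(1) by (intro divide_right_mono real_sqrt_le_mono) (auto simp: mult.commute)
    finally have cs: "c * sqrt d \<le> sqrt ((x - p) * (q - x)) / (12 * N)" .
    have KN: "K \<subseteq> {-N..N}" using N E by force
    have "0 < N" "p < q" using N(1) p(2) q(2) by auto
    from green_lower_bound_in_gap[OF \<open>compact E\<close> E \<open>countable C\<close> gap this(1) KN PN(1)[OF p(1)] this(2) PN(2)[OF q(1)]]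
    obtain s where s: "continuous_on UNIV s"
      "\<forall>z. z \<notin> complex_of_real ` E \<longrightarrow> ennreal (s z) \<le> green E None (Some z)"
      "\<forall>x\<in>{p<..<q}. sqrt ((x - p) * (q - x)) / (12 * N) \<le> s (complex_of_real x)" by blast
    moreover have "c * sqrt d \<le> s (complex_of_real x)"
      using s(3) p(2) q(2) cs by (meson greaterThanLessThan_iff order_trans)
    ultimately show ?thesis unfolding d_def by blast
  qed
  define l where "l = Min ((\<lambda>(a, b). b - a) ` I)"
  have l: "0 < l" "\<And>a b. (a, b) \<in> I \<Longrightarrow> l \<le> b - a"
  proof -
    show "0 < l" unfolding l_def using I by (subst Min_gr_iff) auto
    show "l \<le> b - a" if "(a, b) \<in> I" for a b
      unfolding l_def using I(1) that by (intro Min_le) force+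
  qed
  \<comment> \<open>Bounds the focal quotient at a point of \<open>E\<close> for the interval that
    contains its nearest point of \<open>K\<close>, as that distance is at most 2 N.\<close>
  define M where "M = 1 + 2 * (2 * N) / l"
  define D where "D = 2 * sqrt (M + 1) * sqrt (2 / l)"
  have M: "1 \<le> M" unfolding M_def using N(1) l(1) by simp
  then have D: "0 \<le> D" unfolding D_def using l(1) by simp
  have upper: "\<exists>g. continuous_on UNIV g \<and>
       (\<forall>z. z \<notin> complex_of_real ` E \<longrightarrow> green E None (Some z) \<le> ennreal (g z)) \<and>
       g (complex_of_real x) \<le> D * sqrt (infdist x K)" if x: "x \<in> E" for x
  proof -
    obtain k where k: "k \<in> K" "infdist x K = \<bar>x - k\<bar>" using near by blast
    then obtain a b where ab: "(a, b) \<in> I" "k \<in> {a..b}" unfolding K_def by auto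
    have "a < b" using I(3) ab(1) .
    define A where "A = (cmod (complex_of_real x - complex_of_real a) + cmod (complex_of_real x - complex_of_real b)) / (b - a)"
    have A1: "1 \<le> A" unfolding A_def by (rule focal_sum_ge_1[OF \<open>a < b\<close>])
    have "cmod (complex_of_real x - complex_of_real a) + cmod (complex_of_real x - complex_of_real b) = \<bar>x - a\<bar> + \<bar>x - b\<bar>"
      by (simp only: of_real_diff[symmetric] norm_of_real)
    also have "\<dots> \<le> (b - a) + 2 * \<bar>x - k\<bar>"
      using abs_triangle_ineq[of "x - k" "k - a"] abs_triangle_ineq[of "x - k" "k - b"] ab(2) by simp
    finally have "A \<le> ((b - a) + 2 * \<bar>x - k\<bar>) / (b - a)"
      unfolding A_def using \<open>a < b\<close> by (intro divide_right_mono) auto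
    also have "\<dots> = 1 + 2 * \<bar>x - k\<bar> / (b - a)" using \<open>a < b\<close> by (simp add: add_divide_distrib)
    also have "\<dots> \<le> 1 + 2 * \<bar>x - k\<bar> / l"
      using l(1) l(2)[OF ab(1)] by (intro add_left_mono divide_left_mono) auto
    finally have A2: "A - 1 \<le> 2 / l * infdist x K" using k(2) by simp
    also have "\<dots> \<le> 2 / l * (2 * N)" using d_le[OF x] l(1) by (intro mult_left_mono) auto
    finally have "A \<le> M" unfolding M_def by simp
    from arcosh_le_sqrt[OF A1 this]
    have "interval_green a b (complex_of_real x) \<le> 2 * sqrt (M + 1) * sqrt (A - 1)"
      unfolding interval_green_def A_def .
    also have "\<dots> \<le> 2 * sqrt (M + 1) * sqrt (2 / l * infdist x K)"
      using A2 M by (intro mult_left_mono real_sqrt_le_mono) auto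
    also have "\<dots> = D * sqrt (infdist x K)" unfolding D_def real_sqrt_mult by simp
    finally have "interval_green a b (complex_of_real x) \<le> D * sqrt (infdist x K)" .
    moreover have "{a..b} \<subseteq> E" using IK[OF ab(1)] E by blast
    ultimately show ?thesis
      using continuous_on_interval_green[OF \<open>a < b\<close>] green_upper_bound_by_interval[OF \<open>a < b\<close> _ \<open>compact E\<close>]
      by blast
  qed
  show ?thesis using c D lower upper by blast
qed


section \<open>Change of the pole\<close>

definition sphere_inverse :: "sphere \<Rightarrow> sphere" where
  "sphere_inverse p = (case p of None \<Rightarrow> Some 0 | Some z \<Rightarrow> if z = 0 then None else Some (inverse z))"

definition sphere_shift :: "complex \<Rightarrow> sphere \<Rightarrow> sphere" where
  "sphere_shift c = map_option (\<lambda>z. z + c)"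

lemma sphere_inverse_sphere_inverse [simp]: "sphere_inverse (sphere_inverse p) = p"
  by (cases p) (auto simp: sphere_inverse_def)

lemma sphere_inverse_eq_iff: "sphere_inverse p = q \<longleftrightarrow> p = sphere_inverse q"
  by (metis sphere_inverse_sphere_inverse)

lemma sphere_inverse_real_pts:
  assumes "0 \<notin> E"
  shows "sphere_inverse p \<in> real_pts E \<longleftrightarrow> p \<in> real_pts (inverse ` E)"
proof -
  have "sphere_inverse ` real_pts E = real_pts (inverse ` E)"
    using assms unfolding real_pts_def image_image
    by (intro image_cong) (auto simp: sphere_inverse_def)
  then show ?thesis by (metis image_eqI image_iff sphere_inverse_sphere_inverse)
qed

lemma sphere_shift_real_pts:
  "sphere_shift (complex_of_real c) p \<in> real_pts ((\<lambda>x. x + c) ` E) \<longleftrightarrow> p \<in> real_pts E"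
proof (cases p)
  case None
  then show ?thesis by (auto simp: sphere_shift_def real_pts_def)
next
  case (Some z)
  have "z + complex_of_real c = complex_of_real (x + c) \<longleftrightarrow> z = complex_of_real x" for x by simp
  then show ?thesis unfolding Some sphere_shift_def real_pts_def image_image
    by (auto simp del: of_real_add)
qed

text \<open>The hypothesis says that \<open>f\<close> is holomorphic when read in the charts at \<open>p\<close> and \<open>f p\<close>.\<close>

lemma sphere_harmonic_at_compose:
  assumes u: "\<exists>r>0. chart q ` ball 0 r \<subseteq> S \<and> harmonic_on (ball 0 r) (u \<circ> chart q)"
    and f: "\<And>p. f p \<in> S \<Longrightarrow> p \<in> T"
    and g: "0 < e" "g holomorphic_on ball 0 e" "g 0 = 0"
    and fg: "\<And>\<zeta>. \<zeta> \<in> ball 0 e \<Longrightarrow> f (chart p \<zeta>) = chart q (g \<zeta>)"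
  shows "\<exists>r>0. chart p ` ball 0 r \<subseteq> T \<and> harmonic_on (ball 0 r) ((u \<circ> f) \<circ> chart p)"
proof -
  obtain r where r: "0 < r" "chart q ` ball 0 r \<subseteq> S" "harmonic_on (ball 0 r) (u \<circ> chart q)"
    using u by blast
  have "continuous_on (ball 0 e) g" using g(2) by (rule holomorphic_on_imp_continuous_on)
  then have "open (ball 0 e \<inter> g -` ball 0 r)" by (intro continuous_open_preimage) auto
  moreover have "0 \<in> ball 0 e \<inter> g -` ball 0 r" using g r(1) by simp
  ultimately obtain d where d: "0 < d" "ball 0 d \<subseteq> ball 0 e \<inter> g -` ball 0 r"
    using open_contains_ball by blast
  have "harmonic_on (ball 0 d) (\<lambda>\<zeta>. (u \<circ> chart q) (g \<zeta>))"
    by (rule harmonic_on_compose_holomorphic[OF r(3) holomorphic_on_subset[OF g(2)]]) (use d in auto)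
  then have "harmonic_on (ball 0 d) ((u \<circ> f) \<circ> chart p)"
    by (rule harmonic_on_cong) (use d fg in auto)
  moreover have "chart p ` ball 0 d \<subseteq> T"
  proof
    fix x assume "x \<in> chart p ` ball 0 d"
    then obtain \<zeta> where \<zeta>: "x = chart p \<zeta>" "\<zeta> \<in> ball 0 d" by blast
    then have "g \<zeta> \<in> ball 0 r" "\<zeta> \<in> ball 0 e" using d by auto
    then have "f x \<in> S" using \<zeta> fg r(2) by auto
    then show "x \<in> T" by (rule f)
  qed
  ultimately show ?thesis using d(1) by blast
qed

text \<open>Inversion interchanges the charts at 0 and at infinity exactly, so for these two poles
  the logarithmic pole carries over with the same harmonic remainder. At a point a \<noteq> 0 it
  reads 1 / (a + \<zeta>) - 1 / a in the charts.\<close>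

lemma green_candidates_inverse:
  assumes "0 \<notin> E" "w = None \<or> w = Some 0" "u \<in> green_candidates E w"
  shows "u \<circ> sphere_inverse \<in> green_candidates (inverse ` E) (sphere_inverse w)"
proof -
  let ?S = "Omega E - {w}" and ?T = "Omega (inverse ` E) - {sphere_inverse w}"
  have ST: "sphere_inverse p \<in> ?S \<longleftrightarrow> p \<in> ?T" for p
    unfolding Omega_def using sphere_inverse_real_pts[OF assms(1)] sphere_inverse_eq_iff by auto
  have u: "\<exists>r>0. chart p ` ball 0 r \<subseteq> ?S \<and> harmonic_on (ball 0 r) (u \<circ> chart p)"
    if "p \<in> ?S" for p
    using assms(3) that unfolding green_candidates_def sphere_harmonic_on_def by blast
  have "\<exists>r>0. chart p ` ball 0 r \<subseteq> ?T \<and> harmonic_on (ball 0 r) ((u \<circ> sphere_inverse) \<circ> chart p)"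
    if p: "p \<in> ?T" for p
  proof -
    have q: "sphere_inverse p \<in> ?S" using ST p by blast
    consider "p = None" | "p = Some 0" | a where "p = Some a" "a \<noteq> 0" by (cases p) auto
    then show ?thesis
    proof cases
      case 1
      show ?thesis
        by (rule sphere_harmonic_at_compose[OF u[OF q] _ zero_less_one, where g = "\<lambda>\<zeta>. \<zeta>"])
          (use ST 1 in \<open>auto simp: sphere_inverse_def intro: holomorphic_intros\<close>)
    next
      case 2
      show ?thesis
        by (rule sphere_harmonic_at_compose[OF u[OF q] _ zero_less_one, where g = "\<lambda>\<zeta>. \<zeta>"])
          (use ST 2 in \<open>auto simp: sphere_inverse_def intro: holomorphic_intros\<close>)
    next
      case 3
      have ne: "a + \<zeta> \<noteq> 0" if "\<zeta> \<in> ball 0 (cmod a)" for \<zeta>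
        using that by (metis add.inverse_inverse add_eq_0_iff2 dist_0_norm mem_ball norm_minus_cancel order_less_irrefl)
      show ?thesis
      proof (rule sphere_harmonic_at_compose[OF u[OF q], where g = "\<lambda>\<zeta>. inverse (a + \<zeta>) - inverse a" and e = "cmod a"])
        show "(\<lambda>\<zeta>. inverse (a + \<zeta>) - inverse a) holomorphic_on ball 0 (cmod a)"
          using ne by (intro holomorphic_intros) auto
        show "sphere_inverse (chart p \<zeta>) = chart (sphere_inverse p) (inverse (a + \<zeta>) - inverse a)"
          if "\<zeta> \<in> ball 0 (cmod a)" for \<zeta>
          using 3 ne[OF that] by (simp add: sphere_inverse_def)
      qed (use ST 3 in auto)
    qed
  qed
  moreover have "0 < (u \<circ> sphere_inverse) p" if "p \<in> ?T" for p
    using assms(3) that ST unfolding green_candidates_def by auto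
  moreover have "log_pole (sphere_inverse w) (u \<circ> sphere_inverse)"
  proof -
    have "sphere_inverse (chart (sphere_inverse w) \<zeta>) = chart w \<zeta>" for \<zeta>
      using assms(2) by (auto simp: sphere_inverse_def)
    then show ?thesis using assms(3) unfolding green_candidates_def log_pole_def by simp
  qed
  ultimately show ?thesis unfolding green_candidates_def sphere_harmonic_on_def by blast
qed

lemma green_candidates_shift:
  assumes "u \<in> green_candidates ((\<lambda>x. x + c) ` E) (Some (complex_of_real (w + c)))"
  shows "u \<circ> sphere_shift (complex_of_real c) \<in> green_candidates E (Some (complex_of_real w))"
proof -
  let ?c = "complex_of_real c"
  let ?S = "Omega ((\<lambda>x. x + c) ` E) - {Some (complex_of_real (w + c))}"
    and ?T = "Omega E - {Some (complex_of_real w)}"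
  have ST: "sphere_shift ?c p \<in> ?S \<longleftrightarrow> p \<in> ?T" for p
    unfolding Omega_def using sphere_shift_real_pts[of c p E] by (cases p) (auto simp: sphere_shift_def)
  have u: "\<exists>r>0. chart p ` ball 0 r \<subseteq> ?S \<and> harmonic_on (ball 0 r) (u \<circ> chart p)"
    if "p \<in> ?S" for p
    using assms that unfolding green_candidates_def sphere_harmonic_on_def by blast
  have "\<exists>r>0. chart p ` ball 0 r \<subseteq> ?T \<and> harmonic_on (ball 0 r) ((u \<circ> sphere_shift ?c) \<circ> chart p)"
    if p: "p \<in> ?T" for p
  proof -
    have q: "sphere_shift ?c p \<in> ?S" using ST p by blast
    show ?thesis
    proof (cases p)
      case (Some a)
      show ?thesis
        by (rule sphere_harmonic_at_compose[OF u[OF q] _ zero_less_one, where g = "\<lambda>\<zeta>. \<zeta>"])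
          (use ST Some in \<open>auto simp: sphere_shift_def intro: holomorphic_intros\<close>)
    next
      case None
      \<comment> \<open>In the chart at infinity the shift reads \<zeta> / (1 + c \<zeta>); this
        radius ensures |c \<zeta>| < 1.\<close>
      define e where "e = inverse (cmod ?c + 1)"
      have e: "0 < e" unfolding e_def by (smt (verit) inverse_positive_iff_positive norm_ge_zero)
      have ne: "1 + ?c * \<zeta> \<noteq> 0" if "\<zeta> \<in> ball 0 e" for \<zeta>
      proof
        assume "1 + ?c * \<zeta> = 0"
        then have "cmod (?c * \<zeta>) = 1" by (metis add_eq_0_iff norm_minus_cancel norm_one)
        moreover have "cmod (?c * \<zeta>) \<le> cmod ?c * e"
          using that by (auto simp: norm_mult intro!: mult_left_mono)
        moreover have "cmod ?c * e < 1" unfolding e_def by (simp add: field_simps)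
        ultimately show False by simp
      qed
      show ?thesis
      proof (rule sphere_harmonic_at_compose[OF u[OF q] _ e, where g = "\<lambda>\<zeta>. \<zeta> / (1 + ?c * \<zeta>)"])
        show "(\<lambda>\<zeta>. \<zeta> / (1 + ?c * \<zeta>)) holomorphic_on ball 0 e"
          using ne by (intro holomorphic_intros) auto
        show "sphere_shift ?c (chart p \<zeta>) = chart (sphere_shift ?c p) (\<zeta> / (1 + ?c * \<zeta>))"
          if "\<zeta> \<in> ball 0 e" for \<zeta>
          using None ne[OF that] by (auto simp: sphere_shift_def field_simps)
      qed (use ST in auto)
    qed
  qed
  moreover have "0 < (u \<circ> sphere_shift ?c) p" if "p \<in> ?T" for p
    using assms that ST unfolding green_candidates_def by auto
  moreover have "log_pole (Some (complex_of_real w)) (u \<circ> sphere_shift ?c)"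
  proof -
    have "sphere_shift ?c (chart (Some (complex_of_real w)) \<zeta>) = chart (Some (complex_of_real (w + c))) \<zeta>" for \<zeta>
      by (simp add: sphere_shift_def algebra_simps)
    then show ?thesis using assms unfolding green_candidates_def log_pole_def by simp
  qed
  ultimately show ?thesis unfolding green_candidates_def sphere_harmonic_on_def by blast
qed

text \<open>Half of conformal invariance: pulling candidates back along a map gives one inequality,
  and the inverse map will give the other.\<close>

lemma green_le_if_candidate_map:
  assumes "\<And>u. u \<in> green_candidates E' w' \<Longrightarrow> u \<circ> f \<in> green_candidates E w"
    and "f z = w' \<longleftrightarrow> z = w"
  shows "green E w z \<le> green E' w' (f z)"
proof (cases "z = w")
  case True
  then show ?thesis using assms(2) by (simp add: green_def)
next
  case False
  have "green E w z \<le> ennreal (u (f z))" if "u \<in> green_candidates E' w'" for u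
    using assms(1)[OF that] False unfolding green_def by (auto intro: INF_lower2)
  then show ?thesis
    using False assms(2) by (auto simp: green_def intro: INF_greatest)
qed

lemma green_finite_pole:
  assumes "w \<notin> E" "z \<noteq> complex_of_real w"
  shows "green E (Some (complex_of_real w)) (Some z) =
    green ((\<lambda>x. inverse (x - w)) ` E) None (Some (inverse (z - complex_of_real w)))"
proof -
  let ?E0 = "(\<lambda>x. x + - w) ` E" and ?E1 = "(\<lambda>x. inverse (x - w)) ` E"
  let ?f = "\<lambda>p. sphere_inverse (sphere_shift (complex_of_real (- w)) p)"
  let ?g = "\<lambda>p. sphere_shift (complex_of_real w) (sphere_inverse p)"
  have 0: "0 \<notin> ?E0" "0 \<notin> ?E1" using assms(1) by auto
  have E1: "inverse ` ?E0 = ?E1" "inverse ` ?E1 = ?E0" "(\<lambda>x. x + w) ` ?E0 = E"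
    by (auto simp: image_image)
  have "u \<circ> ?f \<in> green_candidates E (Some (complex_of_real w))" if "u \<in> green_candidates ?E1 None" for u
  proof -
    have "u \<circ> sphere_inverse \<in> green_candidates ?E0 (Some 0)"
      using green_candidates_inverse[OF 0(2) _ that] E1(2) by (simp add: sphere_inverse_def)
    then show ?thesis using green_candidates_shift[of "u \<circ> sphere_inverse" "- w" E w]
      by (simp add: o_def)
  qed
  moreover have "u \<circ> ?g \<in> green_candidates ?E1 None"
    if u: "u \<in> green_candidates E (Some (complex_of_real w))" for u
  proof -
    have "u \<circ> sphere_shift (complex_of_real w) \<in> green_candidates ?E0 (Some 0)"
      using green_candidates_shift[of u w ?E0 0] u unfolding E1(3) by simp
    then show ?thesis
      using green_candidates_inverse[OF 0(1), of "Some 0" "u \<circ> sphere_shift (complex_of_real w)"] E1(1)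
      by (simp add: sphere_inverse_def o_def)
  qed
  moreover have fz: "?f (Some z) = Some (inverse (z - complex_of_real w))"
    using assms(2) by (simp add: sphere_inverse_def sphere_shift_def)
  moreover have gf: "?g (Some (inverse (z - complex_of_real w))) = Some z"
    using assms(2) by (simp add: sphere_inverse_def sphere_shift_def)
  ultimately show ?thesis
    using green_le_if_candidate_map[of ?E1 None ?f E "Some (complex_of_real w)" "Some z"]
      green_le_if_candidate_map[of E "Some (complex_of_real w)" ?g ?E1 None "Some (inverse (z - complex_of_real w))"]
      assms(2)
    by (intro antisym) auto
qed


section \<open>Upper boundary values\<close>

text \<open>\<open>E\<close> is real, so a vertical approach avoids it. This makes the filter in
  \<open>green_bdry\<close> nontrivial, which is what lets the upper limit of a continuous function
  equal its value.\<close>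

lemma complex_of_real_islimpt_nonreal:
  "complex_of_real x islimpt {z. Some z \<in> Omega E}"
  unfolding islimpt_approachable
proof (intro allI impI)
  fix e :: real assume e: "0 < e"
  define z where "z = complex_of_real x + \<i> * complex_of_real (e / 2)"
  have "Im z \<noteq> 0" "dist z (complex_of_real x) < e" using e by (auto simp: z_def dist_norm norm_mult)
  then show "\<exists>y\<in>{z. Some z \<in> Omega E}. y \<noteq> complex_of_real x \<and> dist y (complex_of_real x) < e"
    by (intro bexI[of _ z]) (auto simp: Omega_def real_pts_def)
qed

lemma Limsup_at_within_Omega:
  assumes "isCont g (complex_of_real x)"
  shows "Limsup (at (complex_of_real x) within {z. Some z \<in> Omega E}) (\<lambda>z. ennreal (g z))
    = ennreal (g (complex_of_real x))"
proof (rule lim_imp_Limsup)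
  show "at (complex_of_real x) within {z. Some z \<in> Omega E} \<noteq> bot"
    using complex_of_real_islimpt_nonreal by (simp add: trivial_limit_within)
  have "(g \<longlongrightarrow> g (complex_of_real x)) (at (complex_of_real x) within {z. Some z \<in> Omega E})"
    using assms by (simp add: isCont_def tendsto_within_subset[of _ _ _ UNIV])
  then show "((\<lambda>z. ennreal (g z)) \<longlongrightarrow> ennreal (g (complex_of_real x)))
      (at (complex_of_real x) within {z. Some z \<in> Omega E})"
    by (rule tendsto_ennrealI)
qed

lemma eventually_Omega_minus_pole:
  assumes "Some (complex_of_real x) \<noteq> w"
  shows "\<forall>\<^sub>F z in at (complex_of_real x) within {z. Some z \<in> Omega E}.
    z \<notin> complex_of_real ` E \<and> Some z \<noteq> w"
proof -
  have "\<forall>\<^sub>F z in at (complex_of_real x) within {z. Some z \<in> Omega E}. Some z \<in> Omega E"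
    by (simp add: eventually_at_filter)
  moreover have "\<forall>\<^sub>F z in at (complex_of_real x) within {z. Some z \<in> Omega E}. Some z \<noteq> w"
  proof (cases w)
    case (Some v)
    then have "complex_of_real x \<in> - {v}" using assms by auto
    then have "\<forall>\<^sub>F z in nhds (complex_of_real x). z \<in> - {v}"
      by (intro eventually_nhds_in_open) auto
    then show ?thesis unfolding Some eventually_at_filter by (auto elim: eventually_mono)
  qed simp
  ultimately show ?thesis
    by eventually_elim (auto simp: Omega_def real_pts_def)
qed

lemma green_bdry_le:
  assumes "isCont g (complex_of_real x)" "Some (complex_of_real x) \<noteq> w"
    and "\<And>z. z \<notin> complex_of_real ` E \<Longrightarrow> Some z \<noteq> w \<Longrightarrow> green E w (Some z) \<le> ennreal (g z)"
  shows "green_bdry E w x \<le> ennreal (g (complex_of_real x))"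
  unfolding green_bdry_def Limsup_at_within_Omega[OF assms(1), of E, symmetric]
  by (rule Limsup_mono, rule eventually_mono[OF eventually_Omega_minus_pole[OF assms(2), of E]])
    (use assms(3) in blast)

lemma le_green_bdry:
  assumes "isCont s (complex_of_real x)" "Some (complex_of_real x) \<noteq> w"
    and "\<And>z. z \<notin> complex_of_real ` E \<Longrightarrow> Some z \<noteq> w \<Longrightarrow> ennreal (s z) \<le> green E w (Some z)"
  shows "ennreal (s (complex_of_real x)) \<le> green_bdry E w x"
  unfolding green_bdry_def Limsup_at_within_Omega[OF assms(1), of E, symmetric]
  by (rule Limsup_mono, rule eventually_mono[OF eventually_Omega_minus_pole[OF assms(2), of E]])
    (use assms(3) in blast)

section \<open>Distances and boundary values under an inversion\<close>

lemma infdist_image_lower: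
  assumes "K \<noteq> {}" "0 \<le> \<alpha>" "\<And>y. y \<in> K \<Longrightarrow> \<alpha> * dist x y \<le> dist (f x) (f y)"
  shows "\<alpha> * infdist x K \<le> infdist (f x) (f ` K)"
proof -
  have "\<alpha> * infdist x K \<le> dist (f x) (f y)" if "y \<in> K" for y
    using mult_left_mono[OF infdist_le[OF that, of x] assms(2)] assms(3)[OF that] by linarith
  then show ?thesis
    using assms(1) unfolding infdist_def[of "f x"] by (auto intro!: cINF_greatest)
qed

lemma infdist_image_upper:
  assumes "K \<noteq> {}" "0 < \<beta>" "\<And>y. y \<in> K \<Longrightarrow> dist (f x) (f y) \<le> \<beta> * dist x y"
  shows "infdist (f x) (f ` K) \<le> \<beta> * infdist x K"
proof -
  have "infdist (f x) (f ` K) / \<beta> \<le> dist x y" if "y \<in> K" for y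
  proof -
    have "infdist (f x) (f ` K) \<le> \<beta> * dist x y"
      using infdist_le[of "f y" "f ` K" "f x"] assms(3)[OF that] that by fastforce
    then show ?thesis using assms(2) by (simp add: divide_le_eq mult.commute)
  qed
  then have "infdist (f x) (f ` K) / \<beta> \<le> infdist x K"
    using assms(1) unfolding infdist_def[of x] by (auto intro!: cINF_greatest)
  then show ?thesis using assms(2) by (simp add: divide_le_eq mult.commute)
qed

lemma green_bdry_bounds_pole_infinity:
  fixes I :: "(real \<times> real) set" and E C :: "real set"
  defines "K \<equiv> \<Union>(a, b)\<in>I. {a..b}"
  assumes "finite I" "I \<noteq> {}" "\<And>a b. (a, b) \<in> I \<Longrightarrow> a < b"
    and "compact E" and "E = K \<union> C" and "countable C"
  shows "\<exists>c>0. \<exists>D\<ge>0.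
    (\<forall>x\<in>E - K. ennreal (c * sqrt (infdist x K)) \<le> green_bdry E None x) \<and>
    (\<forall>x\<in>E. green_bdry E None x \<le> ennreal (D * sqrt (infdist x K)))"
proof -
  have "\<exists>c>0. \<exists>D\<ge>0.
    (\<forall>x\<in>E - K. \<exists>s. continuous_on UNIV s \<and>
       (\<forall>z. z \<notin> complex_of_real ` E \<longrightarrow> ennreal (s z) \<le> green E None (Some z)) \<and>
       c * sqrt (infdist x K) \<le> s (complex_of_real x)) \<and>
    (\<forall>x\<in>E. \<exists>g. continuous_on UNIV g \<and>
       (\<forall>z. z \<notin> complex_of_real ` E \<longrightarrow> green E None (Some z) \<le> ennreal (g z)) \<and>
       g (complex_of_real x) \<le> D * sqrt (infdist x K))"
    unfolding K_def
    by (rule green_bounds_pole_infinity[OF assms(2-5) assms(6)[unfolded K_def] assms(7)])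
  then obtain c D where "0 < c" "0 \<le> D"
    and s: "\<And>x. x \<in> E - K \<Longrightarrow> \<exists>s. continuous_on UNIV s \<and>
       (\<forall>z. z \<notin> complex_of_real ` E \<longrightarrow> ennreal (s z) \<le> green E None (Some z)) \<and>
       c * sqrt (infdist x K) \<le> s (complex_of_real x)"
    and g: "\<And>x. x \<in> E \<Longrightarrow> \<exists>g. continuous_on UNIV g \<and>
       (\<forall>z. z \<notin> complex_of_real ` E \<longrightarrow> green E None (Some z) \<le> ennreal (g z)) \<and>
       g (complex_of_real x) \<le> D * sqrt (infdist x K)"
    by blast
  have "ennreal (c * sqrt (infdist x K)) \<le> green_bdry E None x" if "x \<in> E - K" for x
  proof -
    obtain s where "continuous_on UNIV s"
      "\<forall>z. z \<notin> complex_of_real ` E \<longrightarrow> ennreal (s z) \<le> green E None (Some z)"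
      "c * sqrt (infdist x K) \<le> s (complex_of_real x)" using s[OF \<open>x \<in> E - K\<close>] by blast
    note s = this
    have "isCont s (complex_of_real x)" using s(1) by (simp add: continuous_on_eq_continuous_at)
    then have "ennreal (s (complex_of_real x)) \<le> green_bdry E None x"
      using s(2) by (intro le_green_bdry) auto
    then show ?thesis using ennreal_leI[OF s(3)] order_trans by blast
  qed
  moreover have "green_bdry E None x \<le> ennreal (D * sqrt (infdist x K))" if "x \<in> E" for x
  proof -
    obtain g where "continuous_on UNIV g"
      "\<forall>z. z \<notin> complex_of_real ` E \<longrightarrow> green E None (Some z) \<le> ennreal (g z)"
      "g (complex_of_real x) \<le> D * sqrt (infdist x K)" using g[OF \<open>x \<in> E\<close>] by blast
    note g = this
    have "isCont g (complex_of_real x)" using g(1) by (simp add: continuous_on_eq_continuous_at)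
    then have "green_bdry E None x \<le> ennreal (g (complex_of_real x))"
      using g(2) by (intro green_bdry_le) auto
    then show ?thesis using ennreal_leI[OF g(3)] order_trans by blast
  qed
  ultimately show ?thesis using \<open>0 < c\<close> \<open>0 \<le> D\<close> by blast
qed

text \<open>Near \<open>x\<close> the map 1 / (z - w) is a homeomorphism taking the complement of
  \<open>E\<close> to that of its image. The two punctured filters correspond exactly, so the upper
  limits are equal.\<close>

lemma green_bdry_finite_pole:
  assumes "w \<notin> E" "x \<in> E"
  shows "green_bdry E (Some (complex_of_real w)) x =
    green_bdry ((\<lambda>x. inverse (x - w)) ` E) None (inverse (x - w))"
proof -
  let ?E1 = "(\<lambda>x. inverse (x - w)) ` E"
  let ?A = "{z. Some z \<in> Omega E}" and ?B = "{z. Some z \<in> Omega ?E1}"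
  let ?x1 = "complex_of_real (inverse (x - w))"
  define T where "T z = inverse (z - complex_of_real w)" for z
  define S where "S z = inverse z + complex_of_real w" for z
  have "x \<noteq> w" using assms by auto
  have Tx: "T (complex_of_real y) = complex_of_real (inverse (y - w))" for y unfolding T_def by simp
  have ST: "S (T z) = z" "T (S z) = z" for z unfolding S_def T_def by auto
  have inj: "inj T" using ST(1) by (metis injI)
  have AB: "T z \<in> ?B \<longleftrightarrow> z \<in> ?A" for z
  proof -
    have "T z = complex_of_real (inverse (y - w)) \<longleftrightarrow> z = complex_of_real y" for y
      unfolding Tx[symmetric] using inj by (simp add: inj_eq)
    moreover have "Some (T z) \<in> real_pts ?E1 \<longleftrightarrow> (\<exists>y\<in>E. T z = complex_of_real (inverse (y - w)))"
      "Some z \<in> real_pts E \<longleftrightarrow> (\<exists>y\<in>E. z = complex_of_real y)"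
      unfolding real_pts_def by blast+
    ultimately show ?thesis unfolding Omega_def mem_Collect_eq Compl_iff by simp
  qed
  let ?F = "at (complex_of_real x) within ?A" and ?F1 = "at ?x1 within ?B"
  have "filterlim T ?F1 ?F"
    unfolding filterlim_at
  proof
    show "\<forall>\<^sub>F z in ?F. T z \<in> ?B \<and> T z \<noteq> ?x1"
      unfolding eventually_at_filter Tx[symmetric] using AB inj by (auto simp: inj_eq)
    have "((\<lambda>z. T z) \<longlongrightarrow> T (complex_of_real x)) ?F"
      unfolding T_def using \<open>x \<noteq> w\<close> by (intro tendsto_intros) auto
    then show "(T \<longlongrightarrow> ?x1) ?F" unfolding Tx by simp
  qed
  moreover have "filterlim S ?F ?F1"
    unfolding filterlim_at
  proof
    have "S z \<in> ?A \<and> S z \<noteq> complex_of_real x" if "z \<in> ?B" "z \<noteq> ?x1" for z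
      using AB[of "S z"] ST that Tx by metis
    then show "\<forall>\<^sub>F z in ?F1. S z \<in> ?A \<and> S z \<noteq> complex_of_real x"
      unfolding eventually_at_filter by auto
    have "((\<lambda>z. S z) \<longlongrightarrow> S ?x1) ?F1"
      unfolding S_def using \<open>x \<noteq> w\<close> by (intro tendsto_intros) auto
    then show "(S \<longlongrightarrow> complex_of_real x) ?F1" using ST(1) Tx by metis
  qed
  \<comment> \<open>Convergence of \<open>S\<close>, pushed forward by its inverse \<open>T\<close>,
    yields the reverse inequality of filters.\<close>
  then have "filtermap T (filtermap S ?F1) \<le> filtermap T ?F"
    unfolding filterlim_def by (rule filtermap_mono)
  then have "?F1 \<le> filtermap T ?F" by (simp add: filtermap_filtermap ST)
  ultimately have eq: "filtermap T ?F = ?F1" unfolding filterlim_def by (intro antisym)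
  have "green_bdry E (Some (complex_of_real w)) x = Limsup ?F (\<lambda>z. green ?E1 None (Some (T z)))"
    unfolding green_bdry_def
  proof (rule Limsup_eq)
    have "Some (complex_of_real x) \<noteq> Some (complex_of_real w)" using \<open>x \<noteq> w\<close> by simp
    from eventually_Omega_minus_pole[OF this, of E]
    show "\<forall>\<^sub>F z in ?F. green E (Some (complex_of_real w)) (Some z) = green ?E1 None (Some (T z))"
      by eventually_elim (use green_finite_pole[OF assms(1)] in \<open>simp add: T_def\<close>)
  qed
  also have "\<dots> = Limsup ?F1 (\<lambda>z. green ?E1 None (Some z))"
    unfolding eq[symmetric]
    by (rule Limsup_filtermap_eq[OF inj, where g = "\<lambda>z. green ?E1 None (Some z)", symmetric])
  finally show ?thesis unfolding green_bdry_def .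
qed

text \<open>A finite pole \<open>w\<close> lies outside \<open>E\<close>, so each interval of
  \<open>K\<close> is on one side of it and 1 / (x - w) maps it to an interval. Distances on
  \<open>E\<close> are divided by |x - w| |y - w|, which lies between d^2 and M^2; under the square
  root this costs the factors 1/M and 1/d.\<close>

lemma green_bdry_bounds:
  fixes I :: "(real \<times> real) set" and E C :: "real set"
  defines "K \<equiv> \<Union>(a, b)\<in>I. {a..b}"
  assumes I: "finite I" "I \<noteq> {}" "\<And>a b. (a, b) \<in> I \<Longrightarrow> a < b"
    and "compact E" and E: "E = K \<union> C" and "countable C"
    and p: "p \<in> extended_reals - real_pts E"
  shows "\<exists>c>0. \<exists>D\<ge>0.
    (\<forall>x\<in>E - K. ennreal (c * sqrt (infdist x K)) \<le> green_bdry E p x) \<and>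
    (\<forall>x\<in>E. green_bdry E p x \<le> ennreal (D * sqrt (infdist x K)))"
proof (cases p)
  case None
  show ?thesis
    unfolding None K_def
    by (rule green_bdry_bounds_pole_infinity[OF I \<open>compact E\<close> E[unfolded K_def] \<open>countable C\<close>])
next
  case (Some v)
  then obtain w where w: "p = Some (complex_of_real w)" "w \<notin> E"
    using p unfolding extended_reals_def real_pts_def by auto
  define T where "T x = inverse (x - w)" for x
  \<comment> \<open>The endpoints swap because 1 / (x - w) is decreasing on either side of
    \<open>w\<close>.\<close>
  define J where "J = (\<lambda>(a, b). (T b, T a)) ` I"
  have inj: "inj T" unfolding T_def by (auto intro!: injI)
  have dist_T: "dist (T x) (T y) = dist x y / (\<bar>x - w\<bar> * \<bar>y - w\<bar>)" if "x \<in> E" "y \<in> E" for x y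
  proof -
    have ne: "x - w \<noteq> 0" "y - w \<noteq> 0" using that w(2) by auto
    then have "T x - T y = (y - x) / ((x - w) * (y - w))" unfolding T_def by (simp add: field_simps)
    then show ?thesis by (simp add: dist_real_def abs_mult abs_minus_commute)
  qed
  have IK: "{a..b} \<subseteq> K" if "(a, b) \<in> I" for a b using that unfolding K_def by auto
  have side: "b < w \<or> w < a" if "(a, b) \<in> I" for a b
    using IK[OF that] I(3)[OF that] w(2) E by (force simp: not_less)
  have T_less: "T b < T a" if "(a, b) \<in> I" for a b
    using side[OF that] I(3)[OF that] unfolding T_def by (auto intro: less_imp_inverse_less_neg less_imp_inverse_less)
  have T_image: "T ` {a..b} = {T b..T a}" if ab: "(a, b) \<in> I" for a b
  proof (intro subset_antisym subsetI)
    fix y assume "y \<in> T ` {a..b}"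
    then obtain x where x: "y = T x" "x \<in> {a..b}" by blast
    then show "y \<in> {T b..T a}"
      using side[OF ab] unfolding T_def by (auto intro: le_imp_inverse_le le_imp_inverse_le_neg)
  next
    fix y assume y: "y \<in> {T b..T a}"
    have "inverse y + w \<in> {a..b}"
    proof (cases "w < a")
      case True
      then have "0 < T b" using I(3)[OF ab] unfolding T_def by auto
      then have "inverse (T a) \<le> inverse y" "inverse y \<le> inverse (T b)"
        using y by (auto intro!: le_imp_inverse_le)
      then show ?thesis unfolding T_def by auto
    next
      case False
      then have "T a < 0" using side[OF ab] I(3)[OF ab] unfolding T_def by auto
      then have "inverse (T a) \<le> inverse y" "inverse y \<le> inverse (T b)"
        using y by (auto intro!: le_imp_inverse_le_neg)
      then show ?thesis unfolding T_def by auto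
    qed
    moreover have "y = T (inverse y + w)" unfolding T_def by simp
    ultimately show "y \<in> T ` {a..b}" by blast
  qed
  have KJ: "(\<Union>(a, b)\<in>J. {a..b}) = T ` K"
    unfolding J_def K_def image_UN using T_image by (auto simp: split_beta)
  have "finite J" "J \<noteq> {}" "\<And>a b. (a, b) \<in> J \<Longrightarrow> a < b"
    using I(1,2) T_less unfolding J_def by auto
  moreover have "compact (T ` E)"
    unfolding T_def using w(2) \<open>compact E\<close>
    by (intro compact_continuous_image continuous_intros) auto
  moreover have "T ` E = (\<Union>(a, b)\<in>J. {a..b}) \<union> T ` C" unfolding KJ using E by auto
  moreover have "countable (T ` C)" using \<open>countable C\<close> by simp
  ultimately have "\<exists>c>0. \<exists>D\<ge>0.
    (\<forall>x\<in>T ` E - T ` K. ennreal (c * sqrt (infdist x (T ` K))) \<le> green_bdry (T ` E) None x) \<and>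
    (\<forall>x\<in>T ` E. green_bdry (T ` E) None x \<le> ennreal (D * sqrt (infdist x (T ` K))))"
    using green_bdry_bounds_pole_infinity[of J "T ` E" "T ` C"] unfolding KJ by blast
  then obtain c D where cD: "0 < c" "0 \<le> D"
    and lower: "\<And>x. x \<in> T ` E - T ` K \<Longrightarrow> ennreal (c * sqrt (infdist x (T ` K))) \<le> green_bdry (T ` E) None x"
    and upper: "\<And>x. x \<in> T ` E \<Longrightarrow> green_bdry (T ` E) None x \<le> ennreal (D * sqrt (infdist x (T ` K)))"
    by blast
  have bdry: "green_bdry E p x = green_bdry (T ` E) None (T x)" if "x \<in> E" for x
    using green_bdry_finite_pole[OF w(2) that] unfolding w(1) T_def .
  have "K \<noteq> {}" using I(2,3) IK by fastforce
  obtain d where d: "0 < d" "\<And>x. x \<in> E \<Longrightarrow> d \<le> \<bar>x - w\<bar>"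
    using separate_point_closed[OF compact_imp_closed[OF \<open>compact E\<close>] w(2)]
    by (auto simp: dist_real_def abs_minus_commute)
  have pos: "0 < \<bar>x - w\<bar>" if "x \<in> E" for x
    using less_le_trans[OF d(1) d(2)[OF that]] .
  obtain M0 where M0: "\<And>x. x \<in> E \<Longrightarrow> norm x \<le> M0"
    using compact_imp_bounded[OF \<open>compact E\<close>] bounded_iff by metis
  define M where "M = max 1 (M0 + \<bar>w\<bar>)"
  have M: "0 < M" "\<And>x. x \<in> E \<Longrightarrow> \<bar>x - w\<bar> \<le> M"
  proof -
    show "\<bar>x - w\<bar> \<le> M" if "x \<in> E" for x
      using M0[OF that] abs_triangle_ineq4[of x w] unfolding M_def by simp
  qed (simp add: M_def)
  have lo: "1 / (M * M) * infdist x K \<le> infdist (T x) (T ` K)" if x: "x \<in> E" for x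
  proof (rule infdist_image_lower[OF \<open>K \<noteq> {}\<close>])
    fix y assume "y \<in> K"
    then have y: "y \<in> E" using E by blast
    have "dist x y / (M * M) \<le> dist x y / (\<bar>x - w\<bar> * \<bar>y - w\<bar>)"
      by (intro divide_left_mono mult_mono mult_pos_pos)
        (use pos[OF x] pos[OF y] M x y in auto)
    then show "1 / (M * M) * dist x y \<le> dist (T x) (T y)" using dist_T[OF x y] by simp
  qed simp
  have hi: "infdist (T x) (T ` K) \<le> 1 / (d * d) * infdist x K" if x: "x \<in> E" for x
  proof (rule infdist_image_upper[OF \<open>K \<noteq> {}\<close>])
    fix y assume "y \<in> K"
    then have y: "y \<in> E" using E by blast
    have "dist x y / (\<bar>x - w\<bar> * \<bar>y - w\<bar>) \<le> dist x y / (d * d)"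
      by (intro divide_left_mono mult_mono mult_pos_pos)
        (use pos[OF x] pos[OF y] d x y in auto)
    then show "dist (T x) (T y) \<le> 1 / (d * d) * dist x y" using dist_T[OF x y] by simp
  qed (use d in simp)
  have "ennreal (c / M * sqrt (infdist x K)) \<le> green_bdry E p x" if x: "x \<in> E - K" for x
  proof -
    have "x \<in> E" using x by simp
    have "sqrt (1 / (M * M) * infdist x K) = 1 / M * sqrt (infdist x K)"
      unfolding real_sqrt_mult using M(1) by (simp add: real_sqrt_divide)
    then have "c / M * sqrt (infdist x K) = c * sqrt (1 / (M * M) * infdist x K)" by simp
    also have "\<dots> \<le> c * sqrt (infdist (T x) (T ` K))"
      using lo[OF \<open>x \<in> E\<close>] cD(1) by (intro mult_left_mono real_sqrt_le_mono) auto
    finally have "ennreal (c / M * sqrt (infdist x K)) \<le> ennreal (c * sqrt (infdist (T x) (T ` K)))"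
      by (rule ennreal_leI)
    also have "\<dots> \<le> green_bdry (T ` E) None (T x)"
      using x inj by (intro lower) (auto simp: inj_image_mem_iff)
    finally show ?thesis using bdry[OF \<open>x \<in> E\<close>] by simp
  qed
  moreover have "green_bdry E p x \<le> ennreal (D / d * sqrt (infdist x K))" if x: "x \<in> E" for x
  proof -
    have "green_bdry E p x \<le> ennreal (D * sqrt (infdist (T x) (T ` K)))"
      unfolding bdry[OF x] using x by (intro upper) auto
    also have "D * sqrt (infdist (T x) (T ` K)) \<le> D * sqrt (1 / (d * d) * infdist x K)"
      using hi[OF x] cD(2) by (intro mult_left_mono real_sqrt_le_mono) auto
    then have "ennreal (D * sqrt (infdist (T x) (T ` K))) \<le> ennreal (D * sqrt (1 / (d * d) * infdist x K))"
      by (rule ennreal_leI)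
    also have "sqrt (1 / (d * d) * infdist x K) = 1 / d * sqrt (infdist x K)"
      unfolding real_sqrt_mult using d(1) by (simp add: real_sqrt_divide)
    finally show ?thesis by simp
  qed
  ultimately show ?thesis
    using cD M(1) d(1) by (intro exI[of _ "c / M"] exI[of _ "D / d"] conjI) auto
qed


section \<open>Countable sets are polar\<close>

text \<open>By countable additivity some singleton has positive mass, and the kernel is infinite on
  the diagonal, so that atom alone makes the positive part infinite.\<close>

lemma log_energy_countable_eq_infinity:
  assumes "countable K" "\<mu> \<in> prob_measures_on K"
  shows "log_energy \<mu> = \<infinity>"
proof -
  have \<mu>: "sets \<mu> = sets borel" "emeasure \<mu> K = 1" using assms(2) unfolding prob_measures_on_def by auto
  have "\<exists>x\<in>K. emeasure \<mu> {x} \<noteq> 0"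
  proof (rule ccontr)
    assume "\<not> ?thesis"
    then have "(\<integral>\<^sup>+x. emeasure \<mu> {x} \<partial>count_space K) = 0"
      by (subst nn_integral_0_iff_AE) (auto simp: AE_count_space)
    moreover have "emeasure \<mu> K = (\<integral>\<^sup>+x. emeasure \<mu> {x} \<partial>count_space K)"
      using assms(1) \<mu>(1) by (intro emeasure_countable_singleton) auto
    ultimately show False using \<mu>(2) by simp
  qed
  then obtain x where x: "x \<in> K" "emeasure \<mu> {x} \<noteq> 0" by blast
  have mx: "{x} \<in> sets \<mu>" using \<mu>(1) by simp
  have inner: "(\<integral>\<^sup>+ w. e2ennreal (log_kernel x w) \<partial>\<mu>) = \<infinity>"
  proof -
    have "\<infinity> = (\<infinity>::ennreal) * emeasure \<mu> {x}" using x(2) by (simp add: ennreal_top_mult)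
    also have "\<dots> = (\<integral>\<^sup>+ w. \<infinity> * indicator {x} w \<partial>\<mu>)" using mx by simp
    also have "\<dots> \<le> (\<integral>\<^sup>+ w. e2ennreal (log_kernel x w) \<partial>\<mu>)"
      by (intro nn_integral_mono) (auto simp: log_kernel_def indicator_def)
    finally show ?thesis by (simp add: top.extremum_unique)
  qed
  have "\<infinity> = (\<infinity>::ennreal) * emeasure \<mu> {x}" using x(2) by (simp add: ennreal_top_mult)
  also have "\<dots> = (\<integral>\<^sup>+ z. \<infinity> * indicator {x} z \<partial>\<mu>)" using mx by simp
  also have "\<dots> \<le> (\<integral>\<^sup>+ z. \<integral>\<^sup>+ w. e2ennreal (log_kernel z w) \<partial>\<mu> \<partial>\<mu>)"
    using inner by (intro nn_integral_mono) (auto simp: indicator_def)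
  finally have "(\<integral>\<^sup>+ z. \<integral>\<^sup>+ w. e2ennreal (log_kernel z w) \<partial>\<mu> \<partial>\<mu>) = \<infinity>"
    by (simp add: top.extremum_unique)
  \<comment> \<open>In \<open>ereal\<close> subtracting anything from infinity, even infinity, gives
    infinity.\<close>
  then show ?thesis unfolding log_energy_def by simp
qed

lemma non_polar_imp_uncountable:
  assumes "non_polar E"
  shows "uncountable E"
proof
  assume "countable E"
  then have "log_energy \<mu> = \<infinity>" if "\<mu> \<in> prob_measures_on (complex_of_real ` E)" for \<mu>
    using that by (intro log_energy_countable_eq_infinity[of "complex_of_real ` E"]) auto
  then have "robin_constant (complex_of_real ` E) = \<infinity>"
    unfolding robin_constant_def by (metis INF_top_conv(1) top_ereal_def)
  then show False using assms unfolding non_polar_def log_capacity_def by simp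
qed


section \<open>The irregularity coefficient\<close>

lemma infsum_cmult_ennreal:
  fixes f :: "'a \<Rightarrow> ennreal"
  shows "infsum (\<lambda>x. c * f x) A = c * infsum f A"
  by (simp add: nonneg_infsum_complete SUP_mult_left_ennreal sum_distrib_left)

lemma infsum_finite_iff_comparable:
  fixes f g :: "'a \<Rightarrow> ennreal"
  assumes "c \<noteq> 0" "D < \<infinity>"
    and "\<And>x. x \<in> A \<Longrightarrow> c * g x \<le> f x" "\<And>x. x \<in> A \<Longrightarrow> f x \<le> D * g x"
  shows "infsum f A < \<infinity> \<longleftrightarrow> infsum g A < \<infinity>"
proof
  assume "infsum f A < \<infinity>"
  moreover have "c * infsum g A \<le> infsum f A"
    unfolding infsum_cmult_ennreal[symmetric] using assms(3) by (intro infsum_mono nonneg_summable_on_complete) auto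
  ultimately have "c * infsum g A < top" by (simp add: order_le_less_trans)
  then show "infsum g A < \<infinity>" using assms(1) by (auto simp: ennreal_mult_less_top)
next
  assume "infsum g A < \<infinity>"
  then have "D * infsum g A < top" using assms(2) by (simp add: ennreal_mult_less_top)
  moreover have "infsum f A \<le> D * infsum g A"
    unfolding infsum_cmult_ennreal[symmetric] using assms(4) by (intro infsum_mono nonneg_summable_on_complete) auto
  ultimately show "infsum f A < \<infinity>" by (simp add: order_le_less_trans)
qed

theorem theorem5p2:
  fixes E :: "real set" and x_star :: sphere
  assumes "semi_regular E"
    and "x_star \<in> extended_reals - real_pts E"
    and "\<exists>I :: (real \<times> real) set. finite I \<and> (\<forall>(a, b)\<in>I. a \<le> b) \<and>
           regular_points E = (\<Union>(a, b)\<in>I. {a..b})"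
  shows "irregularity_coeff E x_star < \<infinity> \<longleftrightarrow>
    conv_sum (\<lambda>x. ennreal (sqrt (infdist x (regular_points E)))) (irregular_points E) < \<infinity>"
proof (cases "countable (irregular_points E)")
  case False
  then show ?thesis by (simp add: irregularity_coeff_def conv_sum_def)
next
  case True
  have "compact E" "uncountable E"
    using assms(1) non_polar_imp_uncountable unfolding semi_regular_def by auto
  obtain I0 :: "(real \<times> real) set" where I0: "finite I0" "\<forall>(a, b)\<in>I0. a \<le> b"
    "regular_points E = (\<Union>(a, b)\<in>I0. {a..b})" using assms(3) by blast
  \<comment> \<open>The bounds divide by interval lengths. Dropping the degenerate intervals loses
    only finitely many points, which join the countable exceptional set until they are shown not to
    occur.\<close>
  define I where "I = {(a, b) \<in> I0. a < b}"
  define K where "K = (\<Union>(a, b)\<in>I. {a..b})"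
  have E_split: "E = regular_points E \<union> irregular_points E" "regular_points E \<inter> irregular_points E = {}"
    unfolding regular_points_def irregular_points_def by (auto simp: zero_less_iff_neq_zero)
  have K_reg: "K \<subseteq> regular_points E" unfolding K_def I_def I0(3) by auto
  have "regular_points E \<subseteq> K \<union> fst ` I0"
  proof
    fix x assume "x \<in> regular_points E"
    then obtain a b where ab: "(a, b) \<in> I0" "x \<in> {a..b}" unfolding I0(3) by auto
    show "x \<in> K \<union> fst ` I0"
    proof (cases "a < b")
      case True
      then have "(a, b) \<in> I" using ab(1) unfolding I_def by auto
      then show ?thesis using ab(2) unfolding K_def by blast
    next
      case False
      then have "x = fst (a, b)" using ab(2) by simp
      then show ?thesis using ab(1) by blast
    qed
  qed
  then have "E - K \<subseteq> irregular_points E \<union> fst ` I0" using E_split(1) by blast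
  then have "countable (E - K)"
    using True I0(1) by (meson countable_Un countable_finite countable_subset finite_imageI)
  have "E = K \<union> (E - K)" using K_reg E_split(1) by blast
  have "I \<noteq> {}"
  proof
    assume "I = {}"
    then have "K = {}" unfolding K_def by simp
    then show False using \<open>countable (E - K)\<close> \<open>uncountable E\<close> by simp
  qed
  have "finite I" using I0(1) unfolding I_def by (auto intro: finite_subset)
  \<comment> \<open>Kept general in the pole: the pole at infinity, which defines regularity,
    identifies the regular set with \<open>K\<close>, and \<open>x_star\<close> gives the comparison
    of the sums.\<close>
  have bounds: "\<exists>c>0. \<exists>D\<ge>0.
    (\<forall>x\<in>E - K. ennreal (c * sqrt (infdist x K)) \<le> green_bdry E p x) \<and>
    (\<forall>x\<in>E. green_bdry E p x \<le> ennreal (D * sqrt (infdist x K)))"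
    if "p \<in> extended_reals - real_pts E" for p
    unfolding K_def
  proof (rule green_bdry_bounds[OF \<open>finite I\<close> \<open>I \<noteq> {}\<close> _ \<open>compact E\<close> _ \<open>countable (E - K)\<close> that])
    show "a < b" if "(a, b) \<in> I" for a b using that unfolding I_def by simp
    show "E = (\<Union>(a, b)\<in>I. {a..b}) \<union> (E - K)" using \<open>E = K \<union> (E - K)\<close> unfolding K_def .
  qed
  have "closed K" "K \<noteq> {}"
    using \<open>finite I\<close> \<open>I \<noteq> {}\<close> unfolding K_def I_def by (auto intro!: closed_UN)
  have "regular_points E = K"
  proof (rule ccontr)
    assume "regular_points E \<noteq> K"
    then obtain x where x: "x \<in> regular_points E" "x \<notin> K" using K_reg by blast
    have "None \<in> extended_reals - real_pts E" by (auto simp: extended_reals_def real_pts_def)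
    from bounds[OF this] obtain c where c: "0 < c"
      "\<And>x. x \<in> E - K \<Longrightarrow> ennreal (c * sqrt (infdist x K)) \<le> green_bdry E None x" by blast
    have "0 < infdist x K"
      using x(2) in_closed_iff_infdist_zero[OF \<open>closed K\<close> \<open>K \<noteq> {}\<close>, of x] infdist_nonneg[of x K] by simp
    then have "0 < ennreal (c * sqrt (infdist x K))" using c(1) by simp
    also have "\<dots> \<le> green_bdry E None x" using x E_split(1) by (intro c(2)) blast
    finally show False using x(1) unfolding regular_points_def by simp
  qed
  obtain c D where "0 < c" "0 \<le> D"
    and c: "\<And>x. x \<in> E - K \<Longrightarrow> ennreal (c * sqrt (infdist x K)) \<le> green_bdry E x_star x"
    and D: "\<And>x. x \<in> E \<Longrightarrow> green_bdry E x_star x \<le> ennreal (D * sqrt (infdist x K))"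
    using bounds[OF assms(2)] by blast
  have irr: "irregular_points E = E - K" using E_split \<open>regular_points E = K\<close> by blast
  have "infsum (green_bdry E x_star) (E - K) < \<infinity> \<longleftrightarrow>
      infsum (\<lambda>x. ennreal (sqrt (infdist x K))) (E - K) < \<infinity>"
  proof (rule infsum_finite_iff_comparable[where c = "ennreal c" and D = "ennreal D"])
    show "ennreal c * ennreal (sqrt (infdist x K)) \<le> green_bdry E x_star x" if "x \<in> E - K" for x
      using c[OF that] \<open>0 < c\<close> by (simp add: ennreal_mult' less_imp_le infdist_nonneg)
    show "green_bdry E x_star x \<le> ennreal D * ennreal (sqrt (infdist x K))" if "x \<in> E - K" for x
      using D[of x] that \<open>0 \<le> D\<close> by (simp add: ennreal_mult' infdist_nonneg)
  qed (use \<open>0 < c\<close> in auto)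
  then show ?thesis
    unfolding irregularity_coeff_def conv_sum_def \<open>regular_points E = K\<close>
    using True irr by simp
qed

end
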